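(* Let $p$ be a rational prime. Let $\alpha \in \mathbb{Q}_p$ be a $p$-adic algebraic number of degree $d \geq 3$ over $\mathbb{Q}$ and let $\beta \in \mathbb{Q}(\alpha)$ be irrational. Let $\mu$ be a real number such that $(d/2) + 1 < \mu < d$ and let $C_0$ be a positive real number. There exist computable positive real numbers $C_3$ and $C_4$, which depend only on $\alpha$, $\beta$, $\mu$ and $C_0$, with the following property. If $x_1/y_1$ and $x_2/y_2$ are rational numbers in lowest terms such that $H(x_2, y_2) \geq H(x_1, y_1) \geq C_3$ and $$ \left|y_1\alpha - x_1\right|_p < \frac{C_0}{H(x_1, y_1)^\mu}, \quad \left|y_2\beta - x_2\right|_p < \frac{C_0}{H(x_2, y_2)^\mu}, $$ then at least one of the following holds: (i) $H(x_2, y_2) > C_4^{-1} H(x_1, y_1)^{\mu - d/2}$; (ii) there exist integers $s, t, u, v$, with $sv - tu \neq 0$, such that $$ \beta = \frac{s\alpha + t}{u\alpha + v} \quad \text{and} \quad \frac{x_2}{y_2} = \frac{sx_1 + ty_1}{ux_1 + vy_1}. $$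
   Context: $|\cdot|_p$ denotes the $p$-adic absolute value on the field of $p$-adic numbers $\mathbb{Q}_p$, normalized so that $|p|_p = p^{-1}$. For a rational number $x/y$ in lowest terms ($x, y$ coprime integers, $y \neq 0$), $H(x, y) = \max(|x|, |y|)$ denotes its height, where $|\cdot|$ is the usual Archimedean absolute value. *)

theory Defs
  imports
    Complex_Main
    "HOL-Library.Nat_Bijection"
    "HOL-Computational_Algebra.Computational_Algebra"
    "HOL-Computational_Algebra.Field_as_Ring"
begin

section \<open>The field of p-adic numbers\<close>

text \<open>The \<open>p\<close>-adic absolute value on the rationals, normalised by \<open>|p| = 1/p\<close>.\<close>

definition padic_abs_rat :: "nat \<Rightarrow> rat \<Rightarrow> real" where
  "padic_abs_rat p q =
     (if q = 0 then 0
      else real p powi (int (multiplicity (int p) (snd (quotient_of q)))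
                        - int (multiplicity (int p) (fst (quotient_of q)))))"

text \<open>
  \<open>padic_numbers p abs_p\<close> says that the field \<open>'a\<close> with the absolute value \<open>abs_p\<close> is a
  completion of the rationals with respect to \<open>padic_abs_rat p\<close>, that is, a copy of the field of
  \<open>p\<close>-adic numbers; for prime \<open>p\<close> this determines \<open>'a\<close> and \<open>abs_p\<close> up to a unique isometric
  isomorphism.
\<close>

locale padic_numbers =
  fixes p :: nat and abs_p :: "'a::field_char_0 \<Rightarrow> real"
  assumes abs_nonneg: "0 \<le> abs_p x"
    and abs_eq_0_iff: "abs_p x = 0 \<longleftrightarrow> x = 0"
    and abs_mult: "abs_p (x * y) = abs_p x * abs_p y"
    and abs_add_le: "abs_p (x + y) \<le> abs_p x + abs_p y"
    and abs_of_rat: "abs_p (of_rat q) = padic_abs_rat p q"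
    and rat_dense: "\<epsilon> > 0 \<Longrightarrow> \<exists>q. abs_p (x - of_rat q) < \<epsilon>"
    and complete:
      "(\<And>\<epsilon>. \<epsilon> > 0 \<Longrightarrow> \<exists>N. \<forall>m\<ge>N. \<forall>n\<ge>N. abs_p (X m - X n) < \<epsilon>)
        \<Longrightarrow> \<exists>l. (\<lambda>n. abs_p (X n - l)) \<longlonglongrightarrow> 0"


section \<open>Algebraic numbers over the rationals\<close>

definition min_poly :: "'a::field_char_0 \<Rightarrow> rat poly" where
  "min_poly \<alpha> = (THE f. lead_coeff f = 1 \<and> irreducible f \<and> poly (map_poly of_rat f) \<alpha> = 0)"

definition alg_degree :: "'a::field_char_0 \<Rightarrow> nat" where
  "alg_degree \<alpha> = degree (min_poly \<alpha>)"

definition rat_adjoin :: "'a::field_char_0 \<Rightarrow> 'a set" where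
  "rat_adjoin \<alpha> =
     {poly (map_poly of_rat g) \<alpha> / poly (map_poly of_rat h) \<alpha> | g h :: rat poly.
        poly (map_poly of_rat h) \<alpha> \<noteq> 0}"

lemma map_poly_of_rat_add:
  "map_poly of_rat (f + g) = (map_poly of_rat f + map_poly of_rat g :: 'a::field_char_0 poly)"
  by (rule poly_eqI) (simp add: coeff_map_poly of_rat_add)

lemma map_poly_of_rat_mult:
  "map_poly of_rat (f * g) = (map_poly of_rat f * map_poly of_rat g :: 'a::field_char_0 poly)"
  by (rule poly_eqI) (simp add: coeff_map_poly coeff_mult of_rat_sum of_rat_mult)

lemma rat_bezout_root:
  fixes \<alpha> :: "'a::field_char_0" and f g :: "rat poly"
  assumes "irreducible f" "poly (map_poly of_rat f) \<alpha> = 0" "\<not> f dvd g"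
  obtains b where "poly (map_poly of_rat b) \<alpha> * poly (map_poly of_rat g) \<alpha> = 1"
proof -
  have "coprime f g"
    using assms by (intro prime_elem_imp_coprime field_poly_irreducible_imp_prime)
  then obtain a b where "a * f + b * g = 1"
    by (metis bezout_coefficients_fst_snd coprime_iff_gcd_eq_1)
  then have "map_poly of_rat (a * f + b * g) = (1 :: 'a poly)" by simp
  then have "poly (map_poly of_rat (a * f + b * g)) \<alpha> = 1" by simp
  with assms that[of b] show thesis by (simp add: map_poly_of_rat_add map_poly_of_rat_mult)
qed

lemma irreducible_dvd_if_root:
  fixes \<alpha> :: "'a::field_char_0" and f g :: "rat poly"
  assumes "irreducible f" "poly (map_poly of_rat f) \<alpha> = 0" "poly (map_poly of_rat g) \<alpha> = 0"
  shows "f dvd g"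
  using rat_bezout_root[OF assms(1,2), of g] assms(3) by auto

lemma min_poly_ex1:
  fixes \<alpha> :: "'a::field_char_0"
  assumes "algebraic \<alpha>"
  shows "\<exists>!f :: rat poly. lead_coeff f = 1 \<and> irreducible f \<and> poly (map_poly of_rat f) \<alpha> = 0"
proof -
  let ?P = "\<lambda>f :: rat poly. f \<noteq> 0 \<and> poly (map_poly of_rat f) \<alpha> = 0"
  obtain q' where "\<And>i. coeff q' i \<in> \<rat>" and q': "q' \<noteq> 0" "poly q' \<alpha> = 0"
    using assms unfolding algebraic_altdef by blast
  then obtain q where "q' = map_poly of_rat q" using ratpolyE by blast
  with q' have "?P q" by auto
  then obtain f where f: "?P f" and min: "\<And>g. ?P g \<Longrightarrow> degree f \<le> degree g"
    using ex_has_least_nat[of ?P q degree] by blast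
  have "irreducible f"
  proof (rule irreducibleI)
    show "f \<noteq> 0" using f by simp
    show "\<not> is_unit f"
      using f by (auto simp: is_unit_poly_iff map_poly_pCons)
  next
    fix a b assume ab: "f = a * b"
    then have nz: "a \<noteq> 0" "b \<noteq> 0" using f by auto
    then have deg: "degree f = degree a + degree b" using ab by (simp add: degree_mult_eq)
    have "?P a \<or> ?P b" using f ab nz by (simp add: map_poly_of_rat_mult)
    then have "degree a = 0 \<or> degree b = 0" using min deg by fastforce
    then show "is_unit a \<or> is_unit b" using nz by (simp add: is_unit_iff_degree)
  qed
  define h where "h = [:inverse (lead_coeff f):] * f"
  have u: "is_unit [:inverse (lead_coeff f):]" using f by (simp add: is_unit_const_poly_iff dvd_field_iff)
  have "irreducible h" unfolding h_def
    using \<open>irreducible f\<close> irreducible_mult_unit_left[OF u] by blast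
  moreover have "lead_coeff h = 1" using f by (simp add: h_def)
  moreover have "poly (map_poly of_rat h) \<alpha> = 0"
    unfolding h_def map_poly_of_rat_mult using f by simp
  moreover have "g = g'" if "lead_coeff g = 1 \<and> irreducible g \<and> poly (map_poly of_rat g) \<alpha> = 0"
    "lead_coeff g' = 1 \<and> irreducible g' \<and> poly (map_poly of_rat g') \<alpha> = 0" for g g' :: "rat poly"
  proof -
    have "g dvd g'" "g' dvd g" using that irreducible_dvd_if_root by blast+
    then obtain c e where c: "g' = g * c" "g = g' * e" unfolding dvd_def by blast
    have "g * (c * e) = g * 1" using c by (metis mult.assoc mult.right_neutral)
    moreover have "g \<noteq> 0" using that(1) by auto
    ultimately have "c * e = 1" unfolding mult_cancel_left by blast
    then have "is_unit c" by (metis dvd_triv_left)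
    then obtain k where "c = [:k:]" by (auto simp: is_unit_poly_iff)
    moreover have "lead_coeff g' = lead_coeff g * lead_coeff c"
      using c(1) by (simp add: lead_coeff_mult)
    ultimately have "c = 1" using that by (simp add: one_pCons)
    with c(1) show ?thesis by simp
  qed
  ultimately show ?thesis by blast
qed

lemma min_poly:
  assumes "algebraic \<alpha>"
  shows "lead_coeff (min_poly \<alpha>) = 1" "irreducible (min_poly \<alpha>)"
    "poly (map_poly of_rat (min_poly \<alpha>)) \<alpha> = 0"
  using theI'[OF min_poly_ex1[OF assms]] unfolding min_poly_def by blast+

lemma rat_adjoin_coordinates:
  assumes "algebraic \<alpha>" "\<beta> \<in> rat_adjoin \<alpha>"
  shows "\<exists>!b. degree b < alg_degree \<alpha> \<and> \<beta> = poly (map_poly of_rat b) \<alpha>"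
proof -
  let ?f = "min_poly \<alpha>"
  note f = min_poly[OF assms(1)]
  have deg: "degree ?f > 0" "?f \<noteq> 0"
    using f by (auto simp: is_unit_iff_degree irreducible_def)
  obtain g h :: "rat poly" where gh: "\<beta> = poly (map_poly of_rat g) \<alpha> / poly (map_poly of_rat h) \<alpha>"
    "poly (map_poly of_rat h) \<alpha> \<noteq> 0"
    using assms(2) unfolding rat_adjoin_def by blast
  have "\<not> ?f dvd h"
    using gh(2) f(3) by (auto elim!: dvdE simp: map_poly_of_rat_mult)
  then obtain k where k: "poly (map_poly of_rat k) \<alpha> * poly (map_poly of_rat h) \<alpha> = 1"
    using rat_bezout_root[OF f(2,3)] by blast
  define b where "b = (k * g) mod ?f"
  have "poly (map_poly of_rat (k * g)) \<alpha> =
      poly (map_poly of_rat ((k * g) div ?f * ?f + b)) \<alpha>" by (simp add: b_def)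
  then have "poly (map_poly of_rat b) \<alpha> = poly (map_poly of_rat (k * g)) \<alpha>"
    unfolding map_poly_of_rat_add using f(3) by (simp add: map_poly_of_rat_mult)
  also have "\<dots> = \<beta>"
    unfolding map_poly_of_rat_mult poly_mult gh(1)
    using k gh(2) by (metis mult.commute nonzero_eq_divide_eq divide_inverse_commute inverse_unique)
  finally have 1: "\<beta> = poly (map_poly of_rat b) \<alpha>" ..
  have 2: "degree b < degree ?f"
    using degree_mod_less'[of ?f "k * g"] deg unfolding b_def by (cases "k * g mod ?f = 0") auto
  have 3: "b = c" if "degree b < degree ?f" "degree c < degree ?f"
    "poly (map_poly of_rat b) \<alpha> = poly (map_poly of_rat c) \<alpha>" for b c
  proof -
    have "poly (map_poly of_rat (b - c + c)) \<alpha> =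
        poly (map_poly of_rat (b - c)) \<alpha> + poly (map_poly of_rat c) \<alpha>"
      unfolding map_poly_of_rat_add by simp
    then have "poly (map_poly of_rat (b - c)) \<alpha> = 0" using that(3) by simp
    then have "?f dvd b - c" using irreducible_dvd_if_root f by blast
    moreover have "degree (b - c) < degree ?f" using that by (simp add: degree_diff_less)
    ultimately show ?thesis using dvd_imp_degree_le[of ?f "b - c"] by (cases "b - c = 0") simp_all
  qed
  show ?thesis unfolding alg_degree_def
    by (rule ex1I[of _ b]) (use 1 2 3 in auto)
qed

definition height :: "int \<Rightarrow> int \<Rightarrow> real" where
  "height x y = of_int (max \<bar>x\<bar> \<bar>y\<bar>)"


section \<open>Computable dependence on given numbers\<close>

text \<open>
  Kleene's partial recursive functions on natural numbers, relative to unary functions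
  \<open>\<phi> 0, \<phi> 1, \<dots>\<close> that a program may query. \<open>evaluates \<phi> f xs y\<close> says that the program \<open>f\<close>
  on the arguments \<open>xs\<close> halts with the value \<open>y\<close>.
\<close>

datatype program =
    Zero | Succ | Proj nat | Query nat
  | Comp program "program list" | PrimRec program program | Minimize program

inductive evaluates :: "(nat \<Rightarrow> nat \<Rightarrow> nat) \<Rightarrow> program \<Rightarrow> nat list \<Rightarrow> nat \<Rightarrow> bool"
  for \<phi> :: "nat \<Rightarrow> nat \<Rightarrow> nat" where
  zero: "evaluates \<phi> Zero xs 0"
| succ: "evaluates \<phi> Succ [x] (Suc x)"
| proj: "i < length xs \<Longrightarrow> evaluates \<phi> (Proj i) xs (xs ! i)"
| query: "evaluates \<phi> (Query i) [x] (\<phi> i x)"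
| comp: "length ys = length gs \<Longrightarrow> (\<forall>i<length gs. evaluates \<phi> (gs ! i) xs (ys ! i))
    \<Longrightarrow> evaluates \<phi> f ys z \<Longrightarrow> evaluates \<phi> (Comp f gs) xs z"
| prim_rec_0: "evaluates \<phi> g xs y \<Longrightarrow> evaluates \<phi> (PrimRec g h) (0 # xs) y"
| prim_rec_Suc: "evaluates \<phi> (PrimRec g h) (n # xs) y \<Longrightarrow> evaluates \<phi> h (n # y # xs) z
    \<Longrightarrow> evaluates \<phi> (PrimRec g h) (Suc n # xs) z"
| minimize: "evaluates \<phi> f (n # xs) 0 \<Longrightarrow> (\<forall>k<n. \<exists>y>0. evaluates \<phi> f (k # xs) y)
    \<Longrightarrow> evaluates \<phi> (Minimize f) xs n"

inductive_cases evaluates_ZeroE: "evaluates \<phi> Zero xs y"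
inductive_cases evaluates_SuccE: "evaluates \<phi> Succ xs y"
inductive_cases evaluates_ProjE: "evaluates \<phi> (Proj i) xs y"
inductive_cases evaluates_QueryE: "evaluates \<phi> (Query i) xs y"
inductive_cases evaluates_CompE: "evaluates \<phi> (Comp f gs) xs y"
inductive_cases evaluates_PrimRec0E: "evaluates \<phi> (PrimRec g h) (0 # xs) y"
inductive_cases evaluates_PrimRecSucE: "evaluates \<phi> (PrimRec g h) (Suc n # xs) y"
inductive_cases evaluates_MinimizeE: "evaluates \<phi> (Minimize f) xs y"

lemma evaluates_deterministic:
  "evaluates \<phi> f xs y \<Longrightarrow> evaluates \<phi> f xs z \<Longrightarrow> y = z"
proof (induction arbitrary: z rule: evaluates.induct)
  case (zero xs)
  then show ?case by (rule evaluates_ZeroE) simp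
next
  case (succ x)
  then show ?case by (rule evaluates_SuccE) simp
next
  case (proj i xs)
  from proj.prems show ?case by (rule evaluates_ProjE) simp
next
  case (query i x)
  then show ?case by (rule evaluates_QueryE) simp
next
  case (comp ys gs xs f w)
  from comp.prems obtain ys' where ys': "length ys' = length gs"
    "\<forall>i<length gs. evaluates \<phi> (gs ! i) xs (ys' ! i)" "evaluates \<phi> f ys' z"
    by (rule evaluates_CompE)
  have "ys = ys'"
    by (rule nth_equalityI) (use comp.hyps comp.IH ys' in simp_all)
  with comp.IH ys' show ?case by blast
next
  case (prim_rec_0 g xs y h)
  from prim_rec_0.prems have "evaluates \<phi> g xs z" by (rule evaluates_PrimRec0E)
  with prim_rec_0.IH show ?case by blast
next
  case (prim_rec_Suc g h n xs y w)
  from prim_rec_Suc.prems obtain y' where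
    "evaluates \<phi> (PrimRec g h) (n # xs) y'" "evaluates \<phi> h (n # y' # xs) z"
    by (rule evaluates_PrimRecSucE)
  with prim_rec_Suc.IH show ?case by blast
next
  case (minimize f n xs)
  from minimize.prems have z: "evaluates \<phi> f (z # xs) 0"
    and below: "\<forall>k<z. \<exists>y>0. evaluates \<phi> f (k # xs) y"
    by (rule evaluates_MinimizeE, blast)+
  have "\<not> n < z" using below minimize.IH(1) by fastforce
  moreover have "\<not> z < n" using z minimize.IH(2) by fastforce
  ultimately show ?case by simp
qed

text \<open>
  Infinite objects are presented to programs by rapidly converging approximations: a real number by
  dyadic rationals, a \<open>p\<close>-adic number by rationals.
\<close>

definition real_name :: "(nat \<Rightarrow> nat) \<Rightarrow> real \<Rightarrow> bool" where
  "real_name \<psi> x \<longleftrightarrow> (\<forall>n. \<bar>x - of_int (int_decode (\<psi> n)) / 2 ^ n\<bar> \<le> 1 / 2 ^ n)"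

definition rat_code :: "rat \<Rightarrow> nat" where
  "rat_code q = prod_encode (int_encode (fst (quotient_of q)), nat (snd (quotient_of q)))"

definition padic_name :: "nat \<Rightarrow> ('a::field_char_0 \<Rightarrow> real) \<Rightarrow> (nat \<Rightarrow> nat) \<Rightarrow> 'a \<Rightarrow> bool" where
  "padic_name p abs_p \<psi> \<alpha> \<longleftrightarrow>
     (\<forall>n. \<exists>q. \<psi> n = rat_code q \<and> abs_p (\<alpha> - of_rat q) \<le> 1 / real p ^ n)"

definition rat_poly_code :: "rat poly \<Rightarrow> nat" where
  "rat_poly_code f = list_encode (map rat_code (coeffs f))"

text \<open>
  The program \<open>e\<close> computes the real number \<open>C\<close> from \<open>\<alpha>\<close>, \<open>\<beta>\<close>, \<open>\<mu>\<close>, \<open>C\<^sub>0\<close>: on input \<open>n\<close> it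
  returns the \<open>n\<close>-th approximation in a name of \<open>C\<close>. It is given \<open>\<alpha>\<close> by its minimal polynomial
  together with \<open>p\<close>-adic approximations (which single out one of the roots), \<open>\<beta>\<close> by its coordinates
  in the basis \<open>1, \<alpha>, \<dots>, \<alpha>^(d-1)\<close>, and \<open>\<mu>\<close> and \<open>C\<^sub>0\<close> by names. The same program has to work for
  all names, and \<open>C\<close> must not depend on them. The coordinate polynomial \<open>b\<close> exists and is unique by
  \<open>rat_adjoin_coordinates\<close>.
\<close>

definition computes_from ::
  "nat \<Rightarrow> ('a::field_char_0 \<Rightarrow> real) \<Rightarrow> program \<Rightarrow> 'a \<Rightarrow> 'a \<Rightarrow> real \<Rightarrow> real \<Rightarrow> real \<Rightarrow> bool" where
  "computes_from p abs_p e \<alpha> \<beta> \<mu> C\<^sub>0 C \<longleftrightarrow>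
     (\<forall>b \<phi>. degree b < alg_degree \<alpha> \<and> \<beta> = poly (map_poly of_rat b) \<alpha> \<and>
        padic_name p abs_p (\<phi> 0) \<alpha> \<and> real_name (\<phi> 1) \<mu> \<and> real_name (\<phi> 2) C\<^sub>0 \<longrightarrow>
        (\<exists>\<psi>. real_name \<psi> C \<and>
           (\<forall>n. evaluates \<phi> e [p, rat_poly_code (min_poly \<alpha>), rat_poly_code b, n] (\<psi> n))))"

end

theory Submission
  imports Defs
begin

text \<open>
  Counting coefficients gives polynomials \<open>A, B\<close> of degree at most \<open>d/2\<close> with
  \<open>\<beta> = A(\<alpha>)/B(\<alpha>)\<close>; a pair whose maximal degree \<open>k\<close> is smallest is coprime. Let \<open>A\<^sub>1, B\<^sub>1\<close> be
  the values at \<open>(x\<^sub>1, y\<^sub>1)\<close> of the forms of degree \<open>k\<close>. The integer \<open>y\<^sub>2 A\<^sub>1 - x\<^sub>2 B\<^sub>1\<close> is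
  \<open>p\<close>-adically of size \<open>O(H\<^sub>1\<^bsup>-\<mu>\<^esup>)\<close> and at most \<open>O(H\<^sub>1\<^bsup>k\<^esup> H\<^sub>2)\<close> in absolute value. If it is not
  zero, this is alternative (i). If it is zero, \<open>x\<^sub>2/y\<^sub>2 = A\<^sub>1/B\<^sub>1\<close>, which is alternative (ii) for
  \<open>k = 1\<close>. For \<open>k \<ge> 2\<close> the resultant of \<open>A, B\<close> bounds the common factor, whence
  \<open>H\<^sub>2 \<ge> c H\<^sub>1\<^bsup>k\<^esup> \<ge> c H\<^sub>1\<^sup>2\<close>. The Wronskian of \<open>A, B\<close> has degree below \<open>d\<close>, so \<open>\<alpha>\<close> is a simple zero
  of \<open>A - \<beta> B\<close>, and the quality of the second approximation is that of the first up to a constant: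
  \<open>|y\<^sub>1 \<alpha> - x\<^sub>1| = O(H\<^sub>1\<^bsup>-2\<mu>\<^esup>)\<close>. As \<open>2\<mu> > d\<close>, this contradicts Liouville's inequality.

  Both constants can be taken of the form \<open>2\<^sup>j (1 + C\<^sub>0)\<close>, where the integer \<open>j\<close> is an iterated
  exponential of the codes of the minimal polynomial of \<open>\<alpha>\<close> and of the coordinates of \<open>\<beta>\<close>. This
  depends continuously on \<open>C\<^sub>0\<close>, as a computable function of a real number must, and the iterated
  exponential leaves room for the crudest explicit bounds.
\<close>

section \<open>Iterated exponentials and their computation\<close>

fun tower :: "nat \<Rightarrow> nat \<Rightarrow> nat" where
  "tower 0 m = m"
| "tower (Suc i) m = 2 ^ tower i m"

text \<open>Only growth is recorded, not computability: the program evaluates a tower that dominates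
  a constant, never the constant itself.\<close>

definition elementary :: "(nat \<Rightarrow> nat) \<Rightarrow> bool" where
  "elementary g \<longleftrightarrow> (\<exists>i. \<forall>m. g m \<le> tower i m)"

lemma tower_mono_height: "i \<le> i' \<Longrightarrow> tower i m \<le> tower i' m"
  by (rule lift_Suc_mono_le[where f = "\<lambda>i. tower i m"]) (simp_all add: less_imp_le)

lemma le_tower: "i \<le> tower i m"
proof (induction i)
  case (Suc i)
  have "i < 2 ^ tower i m" using Suc less_exp[of "tower i m"] by linarith
  then show ?case by simp
qed simp

lemma double_le_exp: "2 * n \<le> 2 ^ n" for n :: nat
proof (cases n)
  case (Suc k)
  have "Suc k \<le> 2 ^ k" by (rule Suc_leI[OF less_exp])
  with Suc show ?thesis by simp
qed simp

lemma square_le_tower: "tower i m * tower i m \<le> tower (Suc (Suc i)) m"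
proof -
  have "tower i m * tower i m \<le> 2 ^ tower i m * 2 ^ tower i m"
    by (intro mult_le_mono) (simp_all add: less_imp_le)
  also have "\<dots> = 2 ^ (2 * tower i m)" by (simp add: power_add mult_2)
  also have "\<dots> \<le> 2 ^ (2 ^ tower i m)" by (intro power_increasing double_le_exp) simp
  finally show ?thesis by simp
qed

lemma elementary_pairE:
  assumes "elementary g" "elementary h"
  obtains i where "\<And>m. g m \<le> tower i m" "\<And>m. h m \<le> tower i m"
proof -
  obtain i i' where "\<forall>m. g m \<le> tower i m" "\<forall>m. h m \<le> tower i' m"
    using assms unfolding elementary_def by blast
  then show thesis
    using that[of "max i i'"] tower_mono_height[of i "max i i'"] tower_mono_height[of i' "max i i'"]
    by (meson le_trans max.cobounded1 max.cobounded2)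
qed

lemma elementary_ident: "elementary (\<lambda>m. m)"
  unfolding elementary_def by (rule exI[of _ 0]) simp

lemma elementary_const: "elementary (\<lambda>m. c)"
  unfolding elementary_def using le_tower by blast

lemma elementary_add:
  assumes "elementary g" "elementary h"
  shows "elementary (\<lambda>m. g m + h m)"
proof -
  obtain i where i: "\<And>m. g m \<le> tower i m" "\<And>m. h m \<le> tower i m"
    using elementary_pairE[OF assms] by blast
  have "g m + h m \<le> tower (Suc i) m" for m
    using i[of m] double_le_exp[of "tower i m"] by simp
  then show ?thesis unfolding elementary_def by blast
qed

lemma elementary_mult:
  assumes "elementary g" "elementary h"
  shows "elementary (\<lambda>m. g m * h m)"
proof -
  obtain i where i: "\<And>m. g m \<le> tower i m" "\<And>m. h m \<le> tower i m"
    using elementary_pairE[OF assms] by blast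
  have "g m * h m \<le> tower (Suc (Suc i)) m" for m
    using mult_le_mono[OF i(1)[of m] i(2)[of m]] square_le_tower[of i m] by (rule le_trans)
  then show ?thesis unfolding elementary_def by blast
qed

lemma elementary_power:
  assumes "elementary g" "elementary h"
  shows "elementary (\<lambda>m. g m ^ h m)"
proof -
  obtain i where i: "\<And>m. g m \<le> tower i m" "\<And>m. h m \<le> tower i m"
    using elementary_pairE[OF assms] by blast
  have "g m ^ h m \<le> tower (Suc (Suc (Suc i))) m" for m
  proof -
    \<comment> \<open>The base becomes a power of two, hence at least 1 even when
      \<open>g m = 0\<close>; only then may the exponent be enlarged.\<close>
    have "g m ^ h m \<le> (2 ^ tower i m) ^ h m"
      by (intro power_mono) (use i(1)[of m] in \<open>auto intro: le_trans less_imp_le[OF less_exp]\<close>)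
    also have "\<dots> \<le> 2 ^ (tower i m * tower i m)"
      unfolding power_mult[symmetric] by (intro power_increasing mult_le_mono i) simp_all
    also have "\<dots> \<le> 2 ^ tower (Suc (Suc i)) m" by (intro power_increasing square_le_tower) simp
    finally show ?thesis by simp
  qed
  then show ?thesis unfolding elementary_def by blast
qed

lemma elementary_mono: "elementary h \<Longrightarrow> (\<And>m. g m \<le> h m) \<Longrightarrow> elementary g"
  unfolding elementary_def by (meson le_trans)

section \<open>Programs for towers and for the constants\<close>

lemma evaluates_Comp1:
  "evaluates \<phi> g xs y \<Longrightarrow> evaluates \<phi> f [y] z \<Longrightarrow> evaluates \<phi> (Comp f [g]) xs z"
  by (rule evaluates.comp[of "[y]"]) auto

lemma evaluates_Comp2:
  "evaluates \<phi> g xs y \<Longrightarrow> evaluates \<phi> h xs y' \<Longrightarrow> evaluates \<phi> f [y, y'] z \<Longrightarrow>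
   evaluates \<phi> (Comp f [g, h]) xs z"
  by (rule evaluates.comp[of "[y, y']"]) (auto simp: less_Suc_eq)

lemma evaluates_Proj: "i < length xs \<Longrightarrow> y = xs ! i \<Longrightarrow> evaluates \<phi> (Proj i) xs y"
  by (simp add: evaluates.proj)

definition add_program :: program where
  "add_program = PrimRec (Proj 0) (Comp Succ [Proj 1])"

definition exp2_program :: program where
  "exp2_program = PrimRec (Comp Succ [Zero]) (Comp add_program [Proj 1, Proj 1])"

text \<open>The arguments are the prime, the codes of the minimal polynomial and of the coordinate
  polynomial, and the precision. Positions 1 and 2 are the codes, whose sum is the second argument
  of \<open>tower\<close>.\<close>

fun tower_program :: "nat \<Rightarrow> program" where
  "tower_program 0 = Comp add_program [Proj 1, Proj 2]"
| "tower_program (Suc i) = Comp exp2_program [tower_program i]"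

text \<open>Oracle 2 is the name of \<open>C\<^sub>0\<close>. If \<open>j\<close> is the value of
  the tower, it is asked \<open>j\<close> places beyond the required precision, because
  multiplication by \<open>2 ^ j\<close> magnifies the error by that factor.\<close>

definition constant_program :: "nat \<Rightarrow> program" where
  "constant_program i = (let s = Comp add_program [Proj 3, tower_program i] in
     Comp add_program [Comp (Query 2) [s], Comp exp2_program [Comp Succ [s]]])"

lemma evaluates_add: "evaluates \<phi> add_program [m, n] (m + n)"
  unfolding add_program_def
proof (induction m)
  case 0
  show ?case by (auto intro!: evaluates.prim_rec_0 evaluates_Proj)
next
  case (Suc m)
  have "evaluates \<phi> (Comp Succ [Proj 1]) [m, m + n, n] (Suc (m + n))"
    by (rule evaluates_Comp1[OF evaluates_Proj evaluates.succ]) auto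
  with Suc show ?case by (auto intro: evaluates.prim_rec_Suc)
qed

lemma evaluates_exp2: "evaluates \<phi> exp2_program [m] (2 ^ m)"
  unfolding exp2_program_def
proof (induction m)
  case 0
  show ?case
    by (rule evaluates.prim_rec_0) (use evaluates_Comp1[OF evaluates.zero evaluates.succ] in simp)
next
  case (Suc m)
  have "evaluates \<phi> (Comp add_program [Proj 1, Proj 1]) [m, 2 ^ m] (2 ^ m + 2 ^ m)"
    by (rule evaluates_Comp2[OF evaluates_Proj evaluates_Proj evaluates_add]) auto
  with Suc show ?case by (auto intro: evaluates.prim_rec_Suc simp: mult_2)
qed

lemma evaluates_tower: "evaluates \<phi> (tower_program i) [q, m, m', n] (tower i (m + m'))"
proof (induction i)
  case 0
  show ?case unfolding tower_program.simps
    by (rule evaluates_Comp2[OF evaluates_Proj evaluates_Proj]) (auto intro: evaluates_add)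
next
  case (Suc i)
  then show ?case unfolding tower_program.simps tower.simps
    by (rule evaluates_Comp1[OF _ evaluates_exp2])
qed

lemma evaluates_constant:
  assumes "j = tower i (m + m')"
  shows "evaluates \<phi> (constant_program i) [q, m, m', n] (\<phi> 2 (n + j) + 2 ^ Suc (n + j))"
proof -
  have "evaluates \<phi> (Comp add_program [Proj 3, tower_program i]) [q, m, m', n] (n + j)"
    unfolding assms
    by (rule evaluates_Comp2[OF evaluates_Proj evaluates_tower evaluates_add]) auto
  note s = this
  have "evaluates \<phi> (Comp exp2_program [Comp Succ [Comp add_program [Proj 3, tower_program i]]])
      [q, m, m', n] (2 ^ Suc (n + j))"
    by (rule evaluates_Comp1[OF evaluates_Comp1[OF s evaluates.succ] evaluates_exp2])
  then show ?thesis
    unfolding constant_program_def Let_def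
    by (rule evaluates_Comp2[OF evaluates_Comp1[OF s evaluates.query] _ evaluates_add])
qed

text \<open>For \<open>C\<^sub>0 > 0\<close> every approximation in a name of \<open>C\<^sub>0\<close> is nonnegative, so its code is even and
  adding \<open>2 * m\<close> to the code adds \<open>m\<close> to the number. The factor being a power of two, no rounding
  is needed.\<close>

lemma real_name_shift:
  assumes "real_name \<psi> C" "0 < C"
  shows "real_name (\<lambda>n. \<psi> (n + j) + 2 ^ Suc (n + j)) (2 ^ j * (1 + C))"
  unfolding real_name_def
proof
  fix n
  define z where "z = int_decode (\<psi> (n + j))"
  have z: "\<bar>C - of_int z / 2 ^ (n + j)\<bar> \<le> 1 / 2 ^ (n + j)"
    using assms(1) unfolding real_name_def z_def by blast
  have "0 \<le> z"
  proof (rule ccontr)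
    assume "\<not> 0 \<le> z"
    then have "of_int z \<le> (-1 :: real)" by linarith
    then have "of_int z / 2 ^ (n + j) \<le> (-1 :: real) / 2 ^ (n + j)"
      by (intro divide_right_mono) simp_all
    with z assms(2) show False by simp
  qed
  moreover have "\<psi> (n + j) = int_encode z" by (simp add: z_def)
  ultimately have "\<psi> (n + j) + 2 ^ Suc (n + j) = int_encode (z + 2 ^ (n + j))"
    by (simp add: int_encode_def sum_encode_def nat_add_distrib nat_power_eq)
  then have "of_int (int_decode (\<psi> (n + j) + 2 ^ Suc (n + j))) / 2 ^ n =
      2 ^ j * (1 + of_int z / 2 ^ (n + j) :: real)"
    by (simp add: distrib_left add_divide_distrib power_add add.commute)
  then have "\<bar>2 ^ j * (1 + C) - of_int (int_decode (\<psi> (n + j) + 2 ^ Suc (n + j))) / 2 ^ n\<bar> =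
      2 ^ j * \<bar>C - of_int z / 2 ^ (n + j)\<bar>"
    by (simp add: abs_mult flip: right_diff_distrib)
  also have "\<dots> \<le> 2 ^ j * (1 / 2 ^ (n + j))"
    using z by (rule mult_left_mono) simp
  finally show "\<bar>2 ^ j * (1 + C) - of_int (int_decode (\<psi> (n + j) + 2 ^ Suc (n + j))) / 2 ^ n\<bar>
      \<le> 1 / 2 ^ n"
    by (simp add: power_add)
qed

text \<open>The computation has to succeed for every admissible coordinate polynomial and all names.
  Uniqueness of coordinates leaves only \<open>b\<close>, so the exponent \<open>j\<close> is always
  the same.\<close>

lemma constant_program_computes:
  fixes \<alpha> \<beta> :: "'a::field_char_0"
  assumes "algebraic \<alpha>" "degree b < alg_degree \<alpha>" "\<beta> = poly (map_poly of_rat b) \<alpha>" "0 < C\<^sub>0"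
    and j: "j = tower i (rat_poly_code (min_poly \<alpha>) + rat_poly_code b)"
  shows "computes_from p abs_p (constant_program i) \<alpha> \<beta> \<mu> C\<^sub>0 (2 ^ j * (1 + C\<^sub>0))"
  unfolding computes_from_def
proof (intro allI impI)
  fix b' and \<phi> :: "nat \<Rightarrow> nat \<Rightarrow> nat"
  assume A: "degree b' < alg_degree \<alpha> \<and> \<beta> = poly (map_poly of_rat b') \<alpha> \<and>
        padic_name p abs_p (\<phi> 0) \<alpha> \<and> real_name (\<phi> 1) \<mu> \<and> real_name (\<phi> 2) C\<^sub>0"
  have "\<beta> \<in> rat_adjoin \<alpha>"
    unfolding rat_adjoin_def assms(3)
    by (rule CollectI, rule exI[of _ b], rule exI[of _ 1]) simp
  then have "b' = b" using rat_adjoin_coordinates[OF assms(1)] A assms(2,3) by blast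
  then show "\<exists>\<psi>. real_name \<psi> (2 ^ j * (1 + C\<^sub>0)) \<and>
      (\<forall>n. evaluates \<phi> (constant_program i) [p, rat_poly_code (min_poly \<alpha>), rat_poly_code b', n] (\<psi> n))"
    using evaluates_constant[OF j] real_name_shift[of "\<phi> 2" C\<^sub>0 j] A assms(4) by blast
qed

section \<open>Small solutions of linear equations\<close>

text \<open>The shape is dictated by the elimination of one unknown: coefficients of size
  \<open>N\<close> grow to \<open>2 * N * N\<close>, and back substitution costs a further factor
  \<open>n * N\<close>. The exponent \<open>4 ^ n\<close> pays for both.\<close>

definition solution_bound :: "nat \<Rightarrow> nat \<Rightarrow> nat" where
  "solution_bound n N = (2 * n * N) ^ (4 ^ n)"

lemma solution_bound_ge_1: "1 \<le> n \<Longrightarrow> 1 \<le> N \<Longrightarrow> 1 \<le> solution_bound n N"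
  unfolding solution_bound_def by (rule one_le_power) (simp add: Suc_le_eq)

lemma solution_bound_mono:
  "n \<le> n' \<Longrightarrow> N \<le> N' \<Longrightarrow> solution_bound n N \<le> solution_bound n' N'"
proof (cases "n = 0 \<or> N = 0")
  case False
  assume "n \<le> n'" "N \<le> N'"
  then have "(2 * n * N) ^ (4 ^ n) \<le> (2 * n' * N') ^ (4 ^ n)"
    by (intro power_mono mult_le_mono) simp_all
  also have "\<dots> \<le> (2 * n' * N') ^ (4 ^ n')"
    using False \<open>n \<le> n'\<close> \<open>N \<le> N'\<close> by (intro power_increasing) (auto simp: Suc_le_eq)
  finally show ?thesis by (simp add: solution_bound_def)
qed (auto simp: solution_bound_def power_0_left)

text \<open>With \<open>X = 2 * Suc n * N\<close> one has \<open>n * N \<le> X\<close> and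
  \<open>2 * n * (2 * N * N) \<le> X ^ 2\<close>, and the exponents satisfy
  \<open>1 + 2 * 4 ^ n \<le> 4 ^ Suc n\<close>.\<close>

lemma solution_bound_Suc:
  assumes "1 \<le> n" "1 \<le> N"
  shows "n * N * solution_bound n (2 * N * N) \<le> solution_bound (Suc n) N"
proof -
  define X where "X = 2 * Suc n * N"
  have X: "1 \<le> X" "n * N \<le> X" using assms by (auto simp: X_def Suc_le_eq)
  have "2 * n * (2 * N * N) \<le> X ^ 2"
  proof -
    have "n * 1 \<le> Suc n * Suc n" by (rule mult_le_mono) simp_all
    then have "4 * (N * N) * n \<le> 4 * (N * N) * (Suc n * Suc n)" by (intro mult_le_mono2) simp
    then show ?thesis by (simp add: X_def power2_eq_square algebra_simps)
  qed
  then have "solution_bound n (2 * N * N) \<le> (X ^ 2) ^ (4 ^ n)"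
    unfolding solution_bound_def by (rule power_mono) simp
  then have "n * N * solution_bound n (2 * N * N) \<le> X * X ^ (2 * 4 ^ n)"
    using X by (intro mult_le_mono) (simp_all add: power_mult)
  also have "\<dots> = X ^ Suc (2 * 4 ^ n)" by simp
  also have "\<dots> \<le> X ^ (4 ^ Suc n)"
  proof (rule power_increasing)
    have "(1 :: nat) \<le> 4 ^ n" by simp
    then show "Suc (2 * 4 ^ n) \<le> 4 ^ Suc n" unfolding power_Suc by linarith
  qed (rule X)
  finally show ?thesis by (simp add: solution_bound_def X_def)
qed

text \<open>Gaussian elimination without division; there may be infinitely many equations. Both
  alternatives of the hypothesis are inherited by the system with one unknown eliminated.\<close>

lemma small_solution:
  fixes R :: "('b \<Rightarrow> int) set"
  assumes "finite J" "1 \<le> N" "\<And>r j. r \<in> R \<Longrightarrow> j \<in> J \<Longrightarrow> \<bar>r j\<bar> \<le> int N"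
    and "(finite R \<and> card R < card J) \<or>
      (\<exists>x :: 'b \<Rightarrow> rat. (\<exists>j\<in>J. x j \<noteq> 0) \<and> (\<forall>r\<in>R. (\<Sum>j\<in>J. of_int (r j) * x j) = 0))"
  shows "\<exists>c :: 'b \<Rightarrow> int. (\<exists>j\<in>J. c j \<noteq> 0) \<and> (\<forall>j\<in>J. \<bar>c j\<bar> \<le> int (solution_bound (card J) N)) \<and>
      (\<forall>r\<in>R. (\<Sum>j\<in>J. r j * c j) = 0)"
  using assms
proof (induction J arbitrary: R N rule: finite_induct)
  case empty
  then show ?case by simp
next
  case (insert a J)
  let ?B = "solution_bound (card (insert a J)) N"
  show ?case
  proof (cases "\<forall>r\<in>R. r a = 0")
    case True
    \<comment> \<open>If no equation involves \<open>a\<close>, the unit vector at \<open>a\<close>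
      is a solution.\<close>
    have "(\<Sum>j\<in>insert a J. r j * (if j = a then 1 else 0)) = r a" for r :: "'b \<Rightarrow> int"
    proof -
      have "(\<Sum>j\<in>J. r j * (if j = a then 1 else 0)) = 0"
        using insert.hyps by (intro sum.neutral) auto
      then show ?thesis using insert.hyps by simp
    qed
    moreover have "1 \<le> ?B" using insert.hyps insert.prems by (intro solution_bound_ge_1) auto
    ultimately show ?thesis using True by (intro exI[of _ "\<lambda>j. if j = a then 1 else 0"]) auto
  next
    case False
    then obtain r0 where r0: "r0 \<in> R" "r0 a \<noteq> 0" by blast
    \<comment> \<open>\<open>r0\<close> is the pivot row; in the combination \<open>e r\<close> the
      unknown \<open>a\<close> has coefficient 0, and no division has occurred.\<close>
    define e where "e = (\<lambda>r j. r0 a * r j - r a * r0 j)"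
    define R' where "R' = e ` (R - {r0})"
    have bound: "\<bar>r j\<bar> \<le> int (2 * N * N)" if "r \<in> R'" "j \<in> J" for r j
    proof -
      obtain q where q: "q \<in> R" "r = e q" using \<open>r \<in> R'\<close> unfolding R'_def by blast
      have "\<bar>r j\<bar> \<le> \<bar>r0 a\<bar> * \<bar>q j\<bar> + \<bar>q a\<bar> * \<bar>r0 j\<bar>"
        unfolding q e_def by (metis abs_mult abs_triangle_ineq4)
      also have "\<dots> \<le> int N * int N + int N * int N"
        using q r0 that(2) by (intro add_mono mult_mono insert.prems(2)) auto
      finally show ?thesis by simp
    qed
    have "(finite R' \<and> card R' < card J) \<or>
      (\<exists>x :: 'b \<Rightarrow> rat. (\<exists>j\<in>J. x j \<noteq> 0) \<and> (\<forall>r\<in>R'. (\<Sum>j\<in>J. of_int (r j) * x j) = 0))"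
      using insert.prems(3)
    proof
      assume R: "finite R \<and> card R < card (insert a J)"
      then have "card R' \<le> card (R - {r0})" unfolding R'_def by (intro card_image_le) simp
      also have "\<dots> < card R" using R r0 by (intro psubset_card_mono) auto
      finally have "card R' < card J" using R insert.hyps by simp
      then show ?thesis using R unfolding R'_def by simp
    next
      assume "\<exists>x :: 'b \<Rightarrow> rat. (\<exists>j\<in>insert a J. x j \<noteq> 0) \<and>
        (\<forall>r\<in>R. (\<Sum>j\<in>insert a J. of_int (r j) * x j) = 0)"
      then obtain x :: "'b \<Rightarrow> rat" where x: "\<exists>j\<in>insert a J. x j \<noteq> 0"
        "\<And>r. r \<in> R \<Longrightarrow> (\<Sum>j\<in>insert a J. of_int (r j) * x j) = 0" by blast
      have sum: "(\<Sum>j\<in>J. of_int (r j) * x j) = - of_int (r a) * x a" if "r \<in> R" for r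
        using x(2)[OF that] insert.hyps by (simp add: add_eq_0_iff)
      have "\<exists>j\<in>J. x j \<noteq> 0"
      proof (rule ccontr)
        assume *: "\<not> ?thesis"
        with sum[OF r0(1)] r0(2) have "x a = 0" by simp
        with * x(1) show False by blast
      qed
      moreover have "(\<Sum>j\<in>J. of_int (e r j) * x j) = 0" if "r \<in> R" for r
      proof -
        have "(\<Sum>j\<in>J. of_int (e r j) * x j) =
          of_int (r0 a) * (\<Sum>j\<in>J. of_int (r j) * x j) - of_int (r a) * (\<Sum>j\<in>J. of_int (r0 j) * x j)"
          by (simp add: e_def sum_distrib_left sum_subtractf left_diff_distrib mult.assoc)
        then show ?thesis by (simp add: sum[OF that] sum[OF r0(1)])
      qed
      ultimately show ?thesis unfolding R'_def by blast
    qed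
    moreover have "1 \<le> 2 * N * N" using insert.prems by (simp add: Suc_le_eq)
    ultimately obtain c :: "'b \<Rightarrow> int" where c: "\<exists>j\<in>J. c j \<noteq> 0"
      "\<And>j. j \<in> J \<Longrightarrow> \<bar>c j\<bar> \<le> int (solution_bound (card J) (2 * N * N))"
      "\<And>r. r \<in> R' \<Longrightarrow> (\<Sum>j\<in>J. r j * c j) = 0"
      using insert.IH[of "2 * N * N" R'] bound by blast
    have "1 \<le> card J" using c(1) insert.hyps by (auto simp: Suc_le_eq card_gt_0_iff)
    then have B: "card J * N * solution_bound (card J) (2 * N * N) \<le> ?B"
      using solution_bound_Suc[of "card J" N] insert by simp
    define s where "s = (\<Sum>j\<in>J. r0 j * c j)"
    \<comment> \<open>Back substitution: the value at \<open>a\<close> would be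
      \<open>- s / r0 a\<close>, so the whole solution is multiplied by the pivot to stay
      integral.\<close>
    define c' where "c' = (\<lambda>j. if j = a then - s else r0 a * c j)"
    have c'J: "(\<Sum>j\<in>J. r j * c' j) = r0 a * (\<Sum>j\<in>J. r j * c j)" for r
    proof -
      have "(\<Sum>j\<in>J. r j * c' j) = (\<Sum>j\<in>J. r0 a * (r j * c j))"
        using insert.hyps by (intro sum.cong) (auto simp: c'_def)
      then show ?thesis by (simp add: sum_distrib_left)
    qed
    have "(\<Sum>j\<in>insert a J. r j * c' j) = 0" if "r \<in> R" for r
    proof -
      have "(\<Sum>j\<in>J. e r j * c j) = 0"
        using that c(3)[of "e r"] by (cases "r = r0") (auto simp: R'_def e_def)
      moreover have "(\<Sum>j\<in>J. e r j * c j) = r0 a * (\<Sum>j\<in>J. r j * c j) - r a * s"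
        by (simp add: e_def s_def sum_distrib_left sum_subtractf left_diff_distrib mult.assoc)
      moreover have "c' a = - s" by (simp add: c'_def)
      ultimately show ?thesis using insert.hyps by (simp add: c'J)
    qed
    moreover have "\<bar>c' j\<bar> \<le> int ?B" if "j \<in> insert a J" for j
    proof (cases "j = a")
      case True
      have "\<bar>s\<bar> \<le> (\<Sum>j\<in>J. \<bar>r0 j * c j\<bar>)" unfolding s_def by (rule sum_abs)
      also have "\<dots> \<le> (\<Sum>j\<in>J. int N * int (solution_bound (card J) (2 * N * N)))"
        unfolding abs_mult by (intro sum_mono mult_mono insert.prems(2) c(2)) (use r0 in auto)
      also have "\<dots> = int (card J * N * solution_bound (card J) (2 * N * N))" by simp
      also have "\<dots> \<le> int ?B" using B by (simp only: of_nat_le_iff)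
      finally show ?thesis using True by (simp add: c'_def)
    next
      case False
      then have "\<bar>c' j\<bar> = \<bar>r0 a\<bar> * \<bar>c j\<bar>" by (simp add: c'_def abs_mult)
      also have "\<dots> \<le> int N * int (solution_bound (card J) (2 * N * N))"
        using False that r0 by (intro mult_mono insert.prems(2) c(2)) auto
      also have "\<dots> = int (1 * N * solution_bound (card J) (2 * N * N))" by simp
      also have "\<dots> \<le> int ?B"
        using mult_le_mono1[OF mult_le_mono1[OF \<open>1 \<le> card J\<close>]] B le_trans
        by (simp only: of_nat_le_iff) blast
      finally show ?thesis .
    qed
    moreover have "\<exists>j\<in>insert a J. c' j \<noteq> 0"
      using c(1) r0(2) insert.hyps by (auto simp: c'_def)
    ultimately show ?thesis by blast
  qed
qed

section \<open>Polynomials with bounded integer coefficients\<close>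

text \<open>The type remains \<open>rat poly\<close>, so that divisibility and coprimality are those
  over the field; integrality is part of the bound.\<close>

definition int_bounded :: "nat \<Rightarrow> rat poly \<Rightarrow> bool" where
  "int_bounded L P \<longleftrightarrow> (\<forall>i. \<exists>z :: int. coeff P i = of_int z \<and> \<bar>z\<bar> \<le> int L)"

lemma coeff_sum_monom: "coeff (\<Sum>j<n. monom (g j) j) i = (if i < n then g i else 0)"
  by (simp add: coeff_sum sum.delta)

lemma coeff_sum_monom_mult:
  fixes P :: "'a::comm_semiring_1 poly"
  shows "coeff ((\<Sum>j<n. monom (g j) j) * P) i = (\<Sum>j<n. g j * coeff (monom 1 j * P) i)"
proof -
  have "monom (g j) j * P = smult (g j) (monom 1 j * P)" for j
    by (simp add: smult_monom flip: mult_smult_left)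
  then show ?thesis by (simp add: sum_distrib_right coeff_sum)
qed

text \<open>The unknowns are the coefficients of the multipliers \<open>X t\<close>, and each power
  of the variable gives one equation. Either counting shows that a solution exists, or a rational
  relation is already known; the second alternative yields a small relation even where counting
  fails.\<close>

lemma small_poly_relation:
  fixes P :: "nat \<Rightarrow> rat poly" and n :: "nat \<Rightarrow> nat"
  assumes N: "1 \<le> N" "\<And>t. t < T \<Longrightarrow> int_bounded N (P t)"
    and alt: "(\<exists>m. m < (\<Sum>t<T. n t) \<and> (\<forall>t<T. \<forall>j<n t. \<forall>i\<ge>m. coeff (monom 1 j * P t) i = 0)) \<or>
      (\<exists>X. (\<exists>t<T. X t \<noteq> 0) \<and> (\<forall>t<T. \<forall>i\<ge>n t. coeff (X t) i = 0) \<and> (\<Sum>t<T. X t * P t) = 0)"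
  shows "\<exists>X. (\<exists>t<T. X t \<noteq> 0) \<and>
      (\<forall>t<T. (\<forall>i\<ge>n t. coeff (X t) i = 0) \<and> int_bounded (solution_bound (\<Sum>t<T. n t) N) (X t)) \<and>
      (\<Sum>t<T. X t * P t) = 0"
proof -
  define J where "J = Sigma {..<T} (\<lambda>t. {..<n t})"
  have J: "finite J" "card J = (\<Sum>t<T. n t)" by (simp_all add: J_def)
  \<comment> \<open>For \<open>t < T\<close> the coefficients are integers, so the floor merely
    changes the type.\<close>
  define row where "row = (\<lambda>i (t, j). \<lfloor>coeff (monom 1 j * P t) i\<rfloor>)"
  have row: "coeff (monom 1 j * P t) i = of_int (row i (t, j)) \<and> \<bar>row i (t, j)\<bar> \<le> int N"
    if t: "t < T" for i t j
  proof -
    obtain z where "coeff (P t) (i - j) = of_int z" "\<bar>z\<bar> \<le> int N"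
      using N(2)[OF t] unfolding int_bounded_def by blast
    then show ?thesis by (simp add: row_def coeff_monom_mult)
  qed
  have sum_J: "(\<Sum>(t, j)\<in>J. g t j * coeff (monom 1 j * P t) i) =
      coeff (\<Sum>t<T. (\<Sum>j<n t. monom (g t j) j) * P t) i" for g :: "nat \<Rightarrow> nat \<Rightarrow> rat" and i
    unfolding J_def by (simp add: sum.Sigma[symmetric] coeff_sum coeff_sum_monom_mult)
  \<comment> \<open>\<open>I\<close> is the set of powers that give equations: those below
    \<open>m\<close> in the counting case, all of them when a rational relation is given.\<close>
  obtain I where I: "\<And>i t j. i \<notin> I \<Longrightarrow> (t, j) \<in> J \<Longrightarrow> coeff (monom 1 j * P t) i = 0"
    "(finite (row ` I) \<and> card (row ` I) < card J) \<or>
      (\<exists>x :: _ \<Rightarrow> rat. (\<exists>j\<in>J. x j \<noteq> 0) \<and> (\<forall>r\<in>row ` I. (\<Sum>j\<in>J. of_int (r j) * x j) = 0))"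
    using alt
  proof
    assume "\<exists>m. m < (\<Sum>t<T. n t) \<and> (\<forall>t<T. \<forall>j<n t. \<forall>i\<ge>m. coeff (monom 1 j * P t) i = 0)"
    then obtain m where m: "m < card J" "\<forall>t<T. \<forall>j<n t. \<forall>i\<ge>m. coeff (monom 1 j * P t) i = 0"
      using J(2) by metis
    have "card (row ` {..<m}) < card J" using m(1) card_image_le[of "{..<m}" row] by simp
    then show thesis using that[of "{..<m}"] m(2) by (auto simp: J_def)
  next
    assume "\<exists>X. (\<exists>t<T. X t \<noteq> 0) \<and> (\<forall>t<T. \<forall>i\<ge>n t. coeff (X t) i = 0) \<and> (\<Sum>t<T. X t * P t) = 0"
    then obtain X where X: "\<exists>t<T. X t \<noteq> 0" "\<And>t i. t < T \<Longrightarrow> i \<ge> n t \<Longrightarrow> coeff (X t) i = 0"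
      "(\<Sum>t<T. X t * P t) = 0" by blast
    define x where "x = (\<lambda>(t, j). coeff (X t) j)"
    have X_eq: "X t = (\<Sum>j<n t. monom (coeff (X t) j) j)" if "t < T" for t
      using X(2)[OF that] by (intro poly_eqI) (simp add: coeff_sum_monom)
    have "(\<Sum>j\<in>J. of_int (row i j) * x j) = 0" for i
    proof -
      have "(\<Sum>j\<in>J. of_int (row i j) * x j) =
          (\<Sum>(t, j)\<in>J. coeff (X t) j * coeff (monom 1 j * P t) i)"
        by (intro sum.cong refl) (use row in \<open>auto simp: J_def x_def mult.commute\<close>)
      also have "\<dots> = coeff (\<Sum>t<T. X t * P t) i"
        unfolding sum_J using X_eq by simp
      finally show ?thesis using X(3) by simp
    qed
    moreover have "\<exists>j\<in>J. x j \<noteq> 0"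
    proof -
      obtain t where t: "t < T" "X t \<noteq> 0" using X(1) by blast
      then obtain j where "coeff (X t) j \<noteq> 0" by (metis leading_coeff_0_iff)
      with t X(2) have "(t, j) \<in> J" unfolding J_def by (auto simp: not_le[symmetric])
      with \<open>coeff (X t) j \<noteq> 0\<close> show ?thesis by (intro bexI[of _ "(t, j)"]) (auto simp: x_def)
    qed
    ultimately show thesis using that[of UNIV] by blast
  qed
  have "\<bar>r j\<bar> \<le> int N" if "r \<in> row ` I" "j \<in> J" for r j
    using that row by (auto simp: J_def)
  then obtain c :: "nat \<times> nat \<Rightarrow> int" where c: "\<exists>j\<in>J. c j \<noteq> 0"
    "\<And>j. j \<in> J \<Longrightarrow> \<bar>c j\<bar> \<le> int (solution_bound (card J) N)"
    "\<And>r. r \<in> row ` I \<Longrightarrow> (\<Sum>j\<in>J. r j * c j) = 0"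
    using small_solution[OF J(1) N(1) _ I(2)] by blast
  define X where "X = (\<lambda>t. \<Sum>j<n t. monom (of_int (c (t, j)) :: rat) j)"
  have coeff_X: "coeff (X t) i = (if i < n t then of_int (c (t, i)) else 0)" for t i
    by (simp add: X_def coeff_sum_monom)
  have "int_bounded (solution_bound (card J) N) (X t)" if "t < T" for t
    unfolding int_bounded_def coeff_X
  proof
    fix i
    show "\<exists>z. (if i < n t then of_int (c (t, i)) else 0) = (of_int z :: rat) \<and>
        \<bar>z\<bar> \<le> int (solution_bound (card J) N)"
      using c(2)[of "(t, i)"] that
      by (intro exI[of _ "if i < n t then c (t, i) else 0"]) (auto simp: J_def)
  qed
  moreover have "\<exists>t<T. X t \<noteq> 0"
  proof -
    obtain t j where tj: "(t, j) \<in> J" "c (t, j) \<noteq> 0" using c(1) by auto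
    then have "coeff (X t) j \<noteq> 0" by (simp add: coeff_X J_def)
    then have "X t \<noteq> 0" by auto
    with tj show ?thesis by (auto simp: J_def)
  qed
  moreover have "(\<Sum>t<T. X t * P t) = 0"
  proof (rule poly_eqI)
    fix i
    have "coeff (\<Sum>t<T. X t * P t) i = (\<Sum>(t, j)\<in>J. of_int (c (t, j)) * coeff (monom 1 j * P t) i)"
      unfolding X_def using sum_J[of "\<lambda>t j. of_int (c (t, j))"] by simp
    also have "\<dots> = 0"
    proof (cases "i \<in> I")
      case True
      have "(\<Sum>(t, j)\<in>J. of_int (c (t, j)) * coeff (monom 1 j * P t) i) =
          of_int (\<Sum>j\<in>J. row i j * c j)"
        unfolding of_int_sum
        by (intro sum.cong refl) (use row in \<open>auto simp: J_def mult.commute\<close>)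
      then show ?thesis using c(3) True by simp
    next
      case False
      then show ?thesis using I(1) by (intro sum.neutral) auto
    qed
    finally show "coeff (\<Sum>t<T. X t * P t) i = coeff 0 i" by simp
  qed
  ultimately show ?thesis using J(2) coeff_X by (intro exI[of _ X]) auto
qed

lemma int_bounded_pCons:
  "int_bounded L (pCons a P) \<longleftrightarrow> (\<exists>z :: int. a = of_int z \<and> \<bar>z\<bar> \<le> int L) \<and> int_bounded L P"
proof
  assume *: "int_bounded L (pCons a P)"
  from * have "\<exists>z :: int. coeff (pCons a P) i = of_int z \<and> \<bar>z\<bar> \<le> int L" for i
    unfolding int_bounded_def by blast
  from this[of 0] this[of "Suc _"]
  show "(\<exists>z :: int. a = of_int z \<and> \<bar>z\<bar> \<le> int L) \<and> int_bounded L P"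
    unfolding int_bounded_def by simp
qed (auto simp: int_bounded_def coeff_pCons split: nat.split)

lemma int_bounded_pderiv:
  assumes "int_bounded L P" "degree P \<le> n"
  shows "int_bounded (n * L) (pderiv P)"
  unfolding int_bounded_def
proof
  fix i
  obtain z where z: "coeff P (Suc i) = of_int z" "\<bar>z\<bar> \<le> int L"
    using assms(1) unfolding int_bounded_def by blast
  show "\<exists>z :: int. coeff (pderiv P) i = of_int z \<and> \<bar>z\<bar> \<le> int (n * L)"
  proof (cases "Suc i \<le> n")
    case True
    then have "int (Suc i) * \<bar>z\<bar> \<le> int n * int L" using z(2) by (intro mult_mono) simp_all
    then show ?thesis
      using z(1) by (intro exI[of _ "int (Suc i) * z"]) (simp add: coeff_pderiv abs_mult)
  next
    case False
    then have "coeff P (Suc i) = 0" using assms(2) by (intro coeff_eq_0) simp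
    then show ?thesis by (intro exI[of _ 0]) (simp add: coeff_pderiv)
  qed
qed

text \<open>A coefficient of the product has at most \<open>n + 1\<close> nonzero terms, one for
  each coefficient of \<open>P\<close>.\<close>

lemma int_bounded_mult:
  assumes "int_bounded L P" "int_bounded L' Q" "degree P \<le> n"
  shows "int_bounded ((n + 1) * L * L') (P * Q)"
  unfolding int_bounded_def
proof
  fix i
  obtain g where g: "\<And>j. coeff P j = of_int (g j)" "\<And>j. \<bar>g j\<bar> \<le> int L"
    using assms(1) unfolding int_bounded_def by metis
  obtain h where h: "\<And>j. coeff Q j = of_int (h j)" "\<And>j. \<bar>h j\<bar> \<le> int L'"
    using assms(2) unfolding int_bounded_def by metis
  have g0: "g j = 0" if "n < j" for j
    using g(1)[of j] coeff_eq_0[of P j] that assms(3) by simp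
  have "coeff (P * Q) i = of_int (\<Sum>j\<le>i. g j * h (i - j))"
    by (simp add: coeff_mult g(1) h(1))
  moreover have "\<bar>\<Sum>j\<le>i. g j * h (i - j)\<bar> \<le> (\<Sum>j\<le>i. \<bar>g j * h (i - j)\<bar>)" by (rule sum_abs)
  moreover have "(\<Sum>j\<le>i. \<bar>g j * h (i - j)\<bar>) = (\<Sum>j\<in>{..i} \<inter> {..n}. \<bar>g j * h (i - j)\<bar>)"
    using g0 by (intro sum.mono_neutral_right) auto
  moreover have "\<dots> \<le> (\<Sum>j\<le>n. \<bar>g j * h (i - j)\<bar>)" by (intro sum_mono2) auto
  moreover have "\<dots> \<le> (\<Sum>j\<le>n. int L * int L')"
    unfolding abs_mult by (intro sum_mono mult_mono g h) auto
  moreover have "\<dots> = int ((n + 1) * L * L')" by (simp add: algebra_simps)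
  ultimately show "\<exists>z :: int. coeff (P * Q) i = of_int z \<and> \<bar>z\<bar> \<le> int ((n + 1) * L * L')"
    by (intro exI[of _ "\<Sum>j\<le>i. g j * h (i - j)"]) linarith
qed

lemma int_bounded_mono: "int_bounded L P \<Longrightarrow> L \<le> L' \<Longrightarrow> int_bounded L' P"
  unfolding int_bounded_def by (meson of_nat_mono order_trans)

lemma int_bounded_uminus: "int_bounded L P \<Longrightarrow> int_bounded L (- P)"
  unfolding int_bounded_def by (metis abs_minus_cancel coeff_minus of_int_minus)

lemma int_bounded_diff:
  assumes "int_bounded L P" "int_bounded L' Q"
  shows "int_bounded (L + L') (P - Q)"
  unfolding int_bounded_def
proof
  fix i
  obtain z w where "coeff P i = of_int z" "\<bar>z\<bar> \<le> int L" "coeff Q i = of_int w" "\<bar>w\<bar> \<le> int L'"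
    using assms unfolding int_bounded_def by blast
  then show "\<exists>z :: int. coeff (P - Q) i = of_int z \<and> \<bar>z\<bar> \<le> int (L + L')"
    by (intro exI[of _ "z - w"]) simp
qed

lemma int_bounded_monom: "\<bar>z\<bar> \<le> int L \<Longrightarrow> int_bounded L (monom (of_int z) n)"
  unfolding int_bounded_def by (auto intro: exI[of _ 0])

section \<open>Estimates for polynomials at p-adic numbers\<close>

abbreviation ev :: "rat poly \<Rightarrow> 'a::field_char_0 \<Rightarrow> 'a" where
  "ev P x \<equiv> poly (map_poly of_rat P) x"

lemma ev_add: "ev (P + Q) x = ev P x + ev Q x"
  by (simp add: map_poly_of_rat_add)

lemma ev_mult: "ev (P * Q) x = ev P x * ev Q x"
  by (simp add: map_poly_of_rat_mult)

lemma ev_diff: "ev (P - Q) x = ev P x - ev Q x"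
  using ev_add[of "P - Q" Q x] by simp

lemma ev_pCons: "ev (pCons a P) x = of_rat a + x * ev P x"
  by (simp add: map_poly_pCons)

lemma ev_const: "ev [:a:] x = of_rat a"
  by (simp add: map_poly_pCons)

lemma ev_smult: "ev (smult c P) x = of_rat c * ev P x"
  using ev_mult[of "[:c:]" P x] by (simp add: ev_const)

lemma ev_of_rat: "ev P (of_rat q :: 'a::field_char_0) = of_rat (poly P q)"
  by (induction P) (simp_all add: map_poly_pCons of_rat_add of_rat_mult)

locale padic_field = padic_numbers p abs_p
  for p :: nat and abs_p :: "'a::field_char_0 \<Rightarrow> real" +
  assumes prime_p: "prime p"
begin

lemma abs_0: "abs_p 0 = 0"
  by (simp add: abs_eq_0_iff)

lemma abs_1: "abs_p 1 = 1"
proof -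
  have "abs_p 1 = abs_p 1 * abs_p 1" using abs_mult[of 1 1] by simp
  then show ?thesis by (simp add: abs_eq_0_iff)
qed

lemma abs_minus: "abs_p (- x) = abs_p x"
proof -
  have "abs_p (- 1) ^ 2 = 1" using abs_mult[of "- 1" "- 1"] by (simp add: abs_1 power2_eq_square)
  then have "abs_p (- 1) = 1" using abs_nonneg[of "- 1"] by (simp add: power2_eq_1_iff)
  then show ?thesis using abs_mult[of "- 1" x] by simp
qed

lemma abs_diff_le: "abs_p (x - y) \<le> abs_p x + abs_p y"
  using abs_add_le[of x "- y"] by (simp add: abs_minus)

lemma abs_power: "abs_p (x ^ n) = abs_p x ^ n"
  by (induction n) (simp_all add: abs_1 abs_mult)

lemma abs_of_int:
  assumes "z \<noteq> 0"
  shows "abs_p (of_int z) = 1 / real p ^ multiplicity (int p) z"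
  using abs_of_rat[of "of_int z"] assms
  by (simp add: padic_abs_rat_def power_int_minus inverse_eq_divide)

lemma abs_of_int_le_1: "abs_p (of_int z) \<le> 1"
proof (cases "z = 0")
  case False
  then show ?thesis using prime_p prime_gt_0_nat[of p] by (simp add: abs_of_int divide_le_eq)
qed (simp add: abs_0)

text \<open>The power of \<open>p\<close> dividing \<open>z\<close> is at most
  \<open>\<bar>z\<bar>\<close>. Thus a nonzero integer cannot be small both p-adically and in the
  usual sense, on which the gap and the Liouville inequality rest.\<close>

lemma abs_of_int_ge:
  assumes "z \<noteq> 0"
  shows "1 / real_of_int \<bar>z\<bar> \<le> abs_p (of_int z)"
proof -
  have "int p ^ multiplicity (int p) z dvd z" by (rule multiplicity_dvd)
  then have "int p ^ multiplicity (int p) z \<le> \<bar>z\<bar>"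
    using assms by (metis abs_le_self_iff dvd_abs_iff dvd_imp_le_int abs_ge_self order_trans)
  then have "real_of_int (int p ^ multiplicity (int p) z) \<le> real_of_int \<bar>z\<bar>"
    by (simp only: of_int_le_iff)
  then show ?thesis
    using assms prime_gt_0_nat[OF prime_p] by (simp add: abs_of_int frac_le)
qed

lemma abs_coprime:
  assumes "coprime x (y :: int)"
  shows "abs_p (of_int x) = 1 \<or> abs_p (of_int y) = 1"
proof -
  have *: "abs_p (of_int z) = 1" if "\<not> int p dvd z" for z
    using that by (cases "z = 0") (simp_all add: abs_of_int not_dvd_imp_multiplicity_0)
  have "prime (int p)" using prime_p by simp
  then have "\<not> (int p dvd x \<and> int p dvd y)"
    using assms by (meson coprime_common_divisor not_prime_unit)
  with * show ?thesis by blast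
qed

text \<open>Only the triangle inequality is postulated; the ultrametric one follows by applying it to the
  binomial expansion of large powers.\<close>

lemma abs_add_le_bound:
  assumes "abs_p x \<le> m" "abs_p y \<le> m"
  shows "abs_p (x + y) \<le> m"
proof (rule ccontr)
  assume "\<not> ?thesis"
  then have gt: "m < abs_p (x + y)" by simp
  have "0 \<le> m" using assms(1) abs_nonneg[of x] by linarith
  moreover have "m \<noteq> 0"
  proof
    assume "m = 0"
    then have "x = 0" "y = 0" using assms abs_nonneg[of x] abs_nonneg[of y] abs_eq_0_iff by force+
    with gt \<open>m = 0\<close> show False by (simp add: abs_0)
  qed
  ultimately have m: "0 < m" by simp
  have sum: "abs_p (\<Sum>i\<in>A. g i) \<le> (\<Sum>i\<in>A. abs_p (g i))" if "finite A" for A :: "nat set" and g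
    using that
  proof (induction A rule: finite_induct)
    case (insert i A)
    then show ?case using abs_add_le[of "g i" "sum g A"] by simp
  qed (simp add: abs_0)
  \<comment> \<open>Binomial coefficients are integers and have absolute value at most 1; what
    remains is the number of terms.\<close>
  have pow: "abs_p (x + y) ^ n \<le> real (n + 1) * m ^ n" for n
  proof -
    have "abs_p (of_nat (n choose k) * x ^ k * y ^ (n - k)) \<le> m ^ n" if "k \<le> n" for k
    proof -
      have "abs_p (of_nat (n choose k) * x ^ k * y ^ (n - k)) \<le> 1 * m ^ k * m ^ (n - k)"
        unfolding abs_mult abs_power
        using assms abs_nonneg m abs_of_int_le_1[of "int (n choose k)"]
        by (intro mult_mono power_mono mult_nonneg_nonneg zero_le_power) simp_all
      also have "\<dots> = m ^ n" using that by (simp flip: power_add)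
      finally show ?thesis .
    qed
    then have "(\<Sum>k\<le>n. abs_p (of_nat (n choose k) * x ^ k * y ^ (n - k))) \<le> (\<Sum>k\<le>n. m ^ n)"
      by (intro sum_mono) simp
    moreover have "abs_p ((x + y) ^ n) \<le> (\<Sum>k\<le>n. abs_p (of_nat (n choose k) * x ^ k * y ^ (n - k)))"
      unfolding binomial_ring by (rule sum) simp
    ultimately show ?thesis by (simp add: abs_power)
  qed
  define h where "h = abs_p (x + y) / m - 1"
  have h: "0 < h" "abs_p (x + y) = (1 + h) * m" using gt m by (simp_all add: h_def field_simps)
  obtain n :: nat where n: "2 < real n * h\<^sup>2"
    using reals_Archimedean3[of "h\<^sup>2"] h(1) by (metis zero_less_power)
  then have "n \<noteq> 0" by (metis mult_zero_left not_numeral_less_zero of_nat_0)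
  \<comment> \<open>Bernoulli's inequality is only linear in \<open>n\<close>. Applied to the
    exponent \<open>n\<close> and squared, it gives quadratic growth for the exponent
    \<open>2 * n\<close>, which beats \<open>2 * n + 1\<close> once \<open>n * h^2\<close> exceeds
    2.\<close>
  have "(1 + real n * h)\<^sup>2 \<le> ((1 + h) ^ n)\<^sup>2"
    using Bernoulli_inequality[of h n] h(1) by (intro power_mono) (auto simp: mult_ac)
  also have "\<dots> = (1 + h) ^ (2 * n)" by (simp add: power_mult mult.commute flip: power_mult)
  also have "\<dots> \<le> real (2 * n + 1)"
    using pow[of "2 * n"] m unfolding h(2) power_mult_distrib by simp
  finally have "1 + 2 * (real n * h) + real n * (real n * h\<^sup>2) \<le> 2 * real n + 1"
    by (simp add: power2_eq_square algebra_simps)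
  moreover have "real n * 2 < real n * (real n * h\<^sup>2)" using n \<open>n \<noteq> 0\<close> by (intro mult_strict_left_mono) auto
  moreover have "0 \<le> real n * h" using h(1) by simp
  ultimately show False by linarith
qed

lemma abs_diff_le_bound: "abs_p x \<le> m \<Longrightarrow> abs_p y \<le> m \<Longrightarrow> abs_p (x - y) \<le> m"
  using abs_add_le_bound[of x m "- y"] by (simp add: abs_minus)

text \<open>Integers have absolute value at most 1 and the ultrametric inequality charges nothing
  for the number of terms, so no constant appears in front of \<open>M ^ n\<close>.\<close>

lemma abs_ev_le:
  assumes "int_bounded L P" "degree P \<le> n" "abs_p x \<le> M" "1 \<le> M"
  shows "abs_p (ev P x) \<le> M ^ n"
  using assms(1,2)
proof (induction P arbitrary: n)
  case 0
  then show ?case using assms(4) by (simp add: abs_0)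
next
  case (pCons a P)
  obtain z where z: "a = of_int z" using pCons.prems(1) by (auto simp: int_bounded_pCons)
  have "abs_p (of_int z) \<le> M ^ n"
    using abs_of_int_le_1[of z] one_le_power[OF assms(4), of n] by (rule order_trans)
  moreover have "abs_p (x * ev P x) \<le> M ^ n"
  proof (cases "P = 0")
    case False
    then obtain n' where n': "n = Suc n'" "degree P \<le> n'" using pCons.prems(2) by (cases n) auto
    then have "abs_p (ev P x) \<le> M ^ n'" using pCons by (simp add: int_bounded_pCons)
    then show ?thesis unfolding abs_mult n' power_Suc
      using assms by (intro mult_mono abs_nonneg) auto
  qed (use assms(4) in \<open>simp add: abs_0\<close>)
  ultimately show ?case unfolding ev_pCons z by (simp add: abs_add_le_bound)
qed

text \<open>For \<open>Q = pCons a P\<close> the difference \<open>Q(x) - Q(y)\<close> is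
  \<open>x * (P(x) - P(y)) + (x - y) * P(y)\<close>, and induction applies to the first
  term.\<close>

lemma abs_ev_diff_le:
  assumes "int_bounded L P" "degree P \<le> n" "abs_p x \<le> M" "abs_p y \<le> M" "1 \<le> M"
  shows "abs_p (ev P x - ev P y) \<le> abs_p (x - y) * M ^ n"
  using assms(1,2)
proof (induction P arbitrary: n)
  case 0
  then show ?case using assms(5) abs_nonneg by (simp add: abs_0)
next
  case (pCons a P)
  show ?case
  proof (cases "P = 0")
    case False
    then obtain n' where n': "n = Suc n'" "degree P \<le> n'" using pCons.prems(2) by (cases n) auto
    have P: "int_bounded L P" using pCons.prems(1) by (simp add: int_bounded_pCons)
    have "abs_p (x * (ev P x - ev P y)) \<le> M * (abs_p (x - y) * M ^ n')"
      unfolding abs_mult using assms pCons.IH[OF P n'(2)] by (intro mult_mono abs_nonneg) auto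
    moreover have "abs_p ((x - y) * ev P y) \<le> abs_p (x - y) * M ^ n"
    proof -
      have "abs_p (ev P y) \<le> M ^ n" using n' by (intro abs_ev_le[OF P _ assms(4,5)]) simp
      then show ?thesis unfolding abs_mult by (intro mult_left_mono abs_nonneg)
    qed
    ultimately have "abs_p (x * (ev P x - ev P y) + (x - y) * ev P y) \<le> abs_p (x - y) * M ^ n"
      by (intro abs_add_le_bound) (simp_all add: n' mult_ac)
    then show ?thesis by (simp add: ev_pCons algebra_simps)
  qed (use assms(5) abs_nonneg in \<open>simp add: abs_0 ev_pCons\<close>)
qed

text \<open>Taylor's formula without denominators: prepending a coefficient multiplies the remainder
  by \<open>x\<close> and adds \<open>(x - y) ^ 2\<close> times the derivative of \<open>P\<close>
  at \<open>y\<close>.\<close>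

lemma abs_ev_taylor_le:
  assumes "int_bounded L P" "degree P \<le> n" "abs_p x \<le> M" "abs_p y \<le> M" "1 \<le> M"
  shows "abs_p (ev P x - ev P y - (x - y) * ev (pderiv P) y) \<le> abs_p (x - y) ^ 2 * M ^ n"
  using assms(1,2)
proof (induction P arbitrary: n)
  case 0
  then show ?case using assms(5) abs_nonneg by (simp add: abs_0)
next
  case (pCons a P)
  show ?case
  proof (cases "P = 0")
    case False
    then obtain n' where n': "n = Suc n'" "degree P \<le> n'" using pCons.prems(2) by (cases n) auto
    have P: "int_bounded L P" using pCons.prems(1) by (simp add: int_bounded_pCons)
    let ?E = "ev P x - ev P y - (x - y) * ev (pderiv P) y"
    have "abs_p (x * ?E) \<le> M * (abs_p (x - y) ^ 2 * M ^ n')"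
      unfolding abs_mult using assms pCons.IH[OF P n'(2)] by (intro mult_mono abs_nonneg) auto
    moreover have "abs_p ((x - y) ^ 2 * ev (pderiv P) y) \<le> abs_p (x - y) ^ 2 * M ^ n"
    proof -
      have "abs_p (ev (pderiv P) y) \<le> M ^ n"
        using n' degree_pderiv[of P]
        by (intro abs_ev_le[OF int_bounded_pderiv[OF P order_refl] _ assms(4,5)]) simp
      then show ?thesis unfolding abs_mult abs_power by (intro mult_left_mono) simp_all
    qed
    ultimately have "abs_p (x * ?E + (x - y) ^ 2 * ev (pderiv P) y) \<le> abs_p (x - y) ^ 2 * M ^ n"
      by (intro abs_add_le_bound) (simp_all add: n' mult_ac)
    moreover have "ev (pCons a P) x - ev (pCons a P) y - (x - y) * ev (pderiv (pCons a P)) y =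
        x * ?E + (x - y) ^ 2 * ev (pderiv P) y"
      by (simp add: ev_pCons pderiv_pCons ev_add algebra_simps power2_eq_square)
    ultimately show ?thesis by simp
  qed (use assms(5) abs_nonneg in \<open>simp add: abs_0 ev_pCons pderiv_pCons\<close>)
qed

end

section \<open>Relations with small coefficients between polynomials\<close>

lemma length_le_list_encode: "length xs \<le> list_encode xs"
  by (induction xs) (auto intro: le_trans[OF _ le_prod_encode_2])

lemma le_list_encode: "x \<in> set xs \<Longrightarrow> x \<le> list_encode xs"
  by (induction xs) (auto intro: le_SucI le_trans[OF _ le_prod_encode_2] le_prod_encode_1)

lemma nat_abs_le_int_encode: "nat \<bar>z\<bar> \<le> int_encode z"
  by (cases "0 \<le> z") (simp_all add: int_encode_def sum_encode_def nat_diff_distrib)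

lemma degree_less_rat_poly_code: "f \<noteq> 0 \<Longrightarrow> degree f < rat_poly_code f"
  using length_le_list_encode[of "map rat_code (coeffs f)"]
  by (simp add: rat_poly_code_def length_coeffs_degree)

text \<open>Pairing and list codes dominate their entries, so every denominator is at most
  \<open>m\<close> and divides \<open>fact m\<close>.\<close>

lemma int_bounded_clear_denominators:
  assumes "rat_poly_code f \<le> m"
  shows "int_bounded (fact m * m) (smult (fact m) f)"
  unfolding int_bounded_def
proof
  fix i
  show "\<exists>z :: int. coeff (smult (fact m) f) i = of_int z \<and> \<bar>z\<bar> \<le> int (fact m * m)"
  proof (cases "coeff f i = 0")
    case False
    obtain a c where ac: "quotient_of (coeff f i) = (a, c)" by fastforce
    have q: "coeff f i = of_int a / of_int c" "0 < c"
      using quotient_of_div[OF ac] quotient_of_denom_pos[OF ac] by blast+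
    have "coeff f i \<in> set (coeffs f)"
      using False by (intro coeff_in_coeffs le_degree) auto
    then have "rat_code (coeff f i) \<le> rat_poly_code f"
      unfolding rat_poly_code_def by (intro le_list_encode) simp
    then have code: "prod_encode (int_encode a, nat c) \<le> m" using assms ac by (simp add: rat_code_def)
    then have "nat \<bar>a\<bar> \<le> m"
      using nat_abs_le_int_encode[of a] le_prod_encode_1[of "int_encode a" "nat c"] by linarith
    then have a: "\<bar>a\<bar> \<le> int m" by linarith
    have "nat c \<le> m" using code le_prod_encode_2[of "nat c" "int_encode a"] by linarith
    then have "nat c dvd fact m" using q(2) by (intro dvd_fact) auto
    then obtain k where k: "fact m = nat c * k" by blast
    have fm: "(fact m :: rat) = of_int c * of_nat k"
    proof -
      have "(fact m :: rat) = of_nat (fact m)" by simp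
      also have "\<dots> = of_nat (nat c) * of_nat k" unfolding k by simp
      finally show ?thesis using q(2) by simp
    qed
    have "\<bar>a\<bar> * int k \<le> int m * int (fact m)"
      using a q(2) mult_right_mono[of 1 c "int k"] unfolding k by (intro mult_mono) auto
    then have "coeff (smult (fact m) f) i = of_int (a * int k) \<and> \<bar>a * int k\<bar> \<le> int (fact m * m)"
      using q by (simp add: fm abs_mult mult.commute)
    then show ?thesis by blast
  qed (auto intro: exI[of _ 0])
qed

lemma degree_less_if_coeffs_0:
  assumes "\<And>i. i \<ge> k \<Longrightarrow> coeff U i = 0" "0 < k"
  shows "degree U < k"
proof (rule ccontr)
  assume *: "\<not> degree U < k"
  then have "coeff U (degree U) = 0" using assms(1) by simp
  then have "U = 0" by simp
  with * assms(2) show False by simp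
qed

lemma sum_lessThan_3: "(\<Sum>t<3. g t) = g 0 + g 1 + g (2 :: nat)"
  by (simp add: numeral_3_eq_3 numeral_2_eq_2)

text \<open>\<open>r\<close> takes the place of the resultant. \<open>U\<close>, \<open>V\<close>
  and \<open>r\<close> have \<open>2 * k + 1\<close> coefficients together, against
  \<open>2 * k\<close> equations, so a small nontrivial relation exists, and coprimality excludes
  \<open>r = 0\<close>. The free exponent \<open>e\<close> lets the homogenized right side be a pure
  power of either variable.\<close>

lemma small_bezout_relation:
  assumes cop: "coprime A (B :: rat poly)"
    and deg: "degree A \<le> k" "degree B \<le> k" "degree A = k \<or> degree B = k"
    and "1 \<le> k" "e < 2 * k"
    and N: "1 \<le> N" "int_bounded N A" "int_bounded N B"
  obtains U V and r :: int where "U * A + V * B = monom (of_int r) e" "r \<noteq> 0"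
    "degree U < k" "degree V < k" "int_bounded (solution_bound (2 * k + 1) N) U"
    "int_bounded (solution_bound (2 * k + 1) N) V" "\<bar>r\<bar> \<le> int (solution_bound (2 * k + 1) N)"
proof -
  \<comment> \<open>The third polynomial gets a constant multiplier, which becomes \<open>r\<close>;
    its sign moves \<open>r\<close> to the other side.\<close>
  define P where "P t = (if t = 0 then A else if t = 1 then B else monom (- 1) e)" for t :: nat
  define n where "n t = (if t = 2 then 1 else k)" for t :: nat
  have n: "(\<Sum>t<3. n t) = 2 * k + 1" unfolding sum_lessThan_3 by (simp add: n_def)
  have deg_P: "coeff (monom 1 j * P t) i = 0" if "t < 3" "j < n t" "2 * k \<le> i" for i j t
  proof (cases "t = 2")
    case True
    then show ?thesis using that \<open>e < 2 * k\<close> by (auto simp: P_def n_def coeff_monom_mult)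
  next
    case False
    then have "degree A < i - j" "degree B < i - j" using that deg by (auto simp: n_def)
    then have "coeff A (i - j) = 0" "coeff B (i - j) = 0" by (simp_all add: coeff_eq_0)
    then show ?thesis using False that by (simp add: P_def coeff_monom_mult)
  qed
  have "int_bounded N (P t)" for t
    using N int_bounded_monom[of "- 1" N e] by (simp add: P_def)
  then have "\<exists>X. (\<exists>t<3. X t \<noteq> 0) \<and>
      (\<forall>t<3. (\<forall>i\<ge>n t. coeff (X t) i = 0) \<and> int_bounded (solution_bound (\<Sum>t<3. n t) N) (X t)) \<and>
      (\<Sum>t<3. X t * P t) = 0"
    by (intro small_poly_relation[OF N(1)] disjI1 exI[of _ "2 * k"])
       (auto simp: n intro: deg_P)
  then obtain X where X: "\<exists>t<3. X t \<noteq> 0" "\<And>t i. t < 3 \<Longrightarrow> i \<ge> n t \<Longrightarrow> coeff (X t) i = 0"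
    "\<And>t. t < 3 \<Longrightarrow> int_bounded (solution_bound (2 * k + 1) N) (X t)"
    "(\<Sum>t<3. X t * P t) = 0"
    unfolding n by blast
  from X(4) have X4: "X 0 * A + X 1 * B + X 2 * monom (- 1) e = 0"
    unfolding sum_lessThan_3 by (simp add: P_def)
  have deg_X: "degree (X 0) < k" "degree (X 1) < k" "degree (X 2) < 1"
    using X(2)[of 0] X(2)[of 1] X(2)[of 2] \<open>1 \<le> k\<close>
      degree_less_if_coeffs_0[of k "X 0"] degree_less_if_coeffs_0[of k "X 1"]
      degree_less_if_coeffs_0[of 1 "X 2"]
    by (simp_all add: n_def)
  have "int_bounded (solution_bound (2 * k + 1) N) (X 2)" using X(3)[of 2] by simp
  then obtain r :: int where r: "coeff (X 2) 0 = of_int r" "\<bar>r\<bar> \<le> int (solution_bound (2 * k + 1) N)"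
    unfolding int_bounded_def by blast
  obtain c where "X 2 = [:c:]" using deg_X(3) degree_eq_zeroE by (metis less_one)
  then have X2: "X 2 = [:of_int r:]" using r(1) by simp
  have "[:of_int r:] * monom (- 1) e = - monom (of_int r :: rat) e"
    by (simp add: smult_monom minus_monom)
  then have "X 0 * A + X 1 * B = monom (of_int r) e"
    using X4 unfolding X2 by simp
  moreover have "r \<noteq> 0"
  proof
    \<comment> \<open>Then \<open>A\<close> divides \<open>X 1\<close> and \<open>B\<close> divides
      \<open>X 0\<close>, both of degree below \<open>k\<close>. Whichever of \<open>A\<close>,
      \<open>B\<close> has degree \<open>k\<close> forces its multiple to vanish, and the other
      multiplier vanishes with it.\<close>
    assume "r = 0"
    then have eq: "X 0 * A = - X 1 * B"
      using calculation by (simp add: add_eq_0_iff)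
    have "A dvd X 1 * B" using eq by (metis dvd_minus_iff dvd_triv_right minus_mult_left)
    then have A: "A dvd X 1" using cop by (simp add: coprime_dvd_mult_left_iff)
    have "B dvd X 0 * A" using eq by (metis dvd_triv_right)
    then have B: "B dvd X 0" using cop by (simp add: coprime_dvd_mult_left_iff coprime_commute)
    have "X 0 = 0 \<and> X 1 = 0"
      using deg(3)
    proof
      assume "degree A = k"
      then have "X 1 = 0" using dvd_imp_degree_le[OF A] deg_X by linarith
      moreover have "A \<noteq> 0" using \<open>degree A = k\<close> \<open>1 \<le> k\<close> by auto
      ultimately show ?thesis using eq by simp
    next
      assume "degree B = k"
      then have "X 0 = 0" using dvd_imp_degree_le[OF B] deg_X by linarith
      moreover have "B \<noteq> 0" using \<open>degree B = k\<close> \<open>1 \<le> k\<close> by auto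
      ultimately show ?thesis using eq by simp
    qed
    moreover have "X 2 = 0" using X2 \<open>r = 0\<close> by simp
    moreover have "t = 0 \<or> t = 1 \<or> t = 2" if "t < 3" for t :: nat using that by linarith
    ultimately show False using X(1) by metis
  qed
  ultimately show thesis using that deg_X r(2) X(3)[of 0] X(3)[of 1] by simp
qed

text \<open>If the Wronskian vanished, coprimality would make each polynomial divide its own
  derivative, which in characteristic 0 only constants do.\<close>

lemma coprime_wronskian_nonzero:
  fixes A B :: "rat poly"
  assumes "coprime A B" "degree A \<noteq> 0 \<or> degree B \<noteq> 0"
  shows "pderiv A * B \<noteq> A * pderiv B"
proof
  assume eq: "pderiv A * B = A * pderiv B"
  have const: "degree P = 0" if "P dvd pderiv P" for P :: "rat poly"
  proof (rule ccontr)
    assume *: "degree P \<noteq> 0"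
    then have "pderiv P \<noteq> 0" by (simp add: pderiv_eq_0_iff)
    with that have "degree P \<le> degree (pderiv P)" by (rule dvd_imp_degree_le)
    with * show False by (simp add: degree_pderiv)
  qed
  have "A dvd pderiv A * B" unfolding eq by simp
  then have "A dvd pderiv A" using assms(1) by (simp add: coprime_dvd_mult_left_iff)
  moreover have "B dvd A * pderiv B" unfolding eq[symmetric] by simp
  then have "B dvd pderiv B" using assms(1) by (simp add: coprime_dvd_mult_right_iff coprime_commute)
  ultimately show False using const[of A] const[of B] assms(2) by blast
qed

section \<open>Representing one algebraic number by another\<close>

lemma of_rat_fact: "of_rat (fact n) = (fact n :: 'a::field_char_0)"
  by (metis of_nat_fact of_rat_of_nat_eq)

text \<open>Every constant is a function of a number \<open>m\<close> that is at least the codes of the minimal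
  polynomial of \<open>\<alpha>\<close> and of the coordinate polynomial of \<open>\<beta>\<close>: such an \<open>m\<close> exceeds the degree and
  is at least all numerators and denominators, so that \<open>fact m\<close> is a common denominator.\<close>

definition b_coeff :: "nat \<Rightarrow> nat" where "b_coeff m = fact m * m"
text \<open>\<open>3 * m\<close> dominates the numbers of unknowns that occur:
  \<open>3 * k + 2\<close>, \<open>2 * k + 1\<close> and \<open>2 * d + 1\<close>, where
  \<open>2 * k \<le> d < m\<close>.\<close>

definition b_AB :: "nat \<Rightarrow> nat" where "b_AB m = solution_bound (3 * m) (b_coeff m)"
definition b_bez :: "nat \<Rightarrow> nat" where "b_bez m = solution_bound (3 * m) (b_AB m)"
text \<open>The product terms bound the coefficients of the Wronskian of two polynomials bounded by
  \<open>b_AB m\<close>; the first summand makes the same number a bound for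
  \<open>F\<close>.\<close>

definition b_W :: "nat \<Rightarrow> nat" where
  "b_W m = b_coeff m + ((m + 1) * (m * b_AB m) * b_AB m + (m + 1) * b_AB m * (m * b_AB m))"
definition b_low :: "nat \<Rightarrow> nat" where "b_low m = solution_bound (3 * m) (b_W m)"
text \<open>The next four are the constants of the inequality leading to alternative (i), of the
  comparison of \<open>H\<^sub>1 ^ k\<close> with \<open>H\<^sub>2\<close>, of the closeness at
  which the linear Taylor term dominates, and of the final Liouville estimate.\<close>

definition b_gap :: "nat \<Rightarrow> nat" where "b_gap m = 2 * (m + 1) * b_AB m * fact m ^ m"
definition b_height :: "nat \<Rightarrow> nat" where "b_height m = 2 * m * b_bez m ^ 3"
definition b_small :: "nat \<Rightarrow> nat" where "b_small m = 4 * fact m ^ (3 * m + 1) * b_low m"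
definition b_end :: "nat \<Rightarrow> nat" where "b_end m = 2 * (m + 1) * b_coeff m * b_low m * fact m ^ (3 * m)"
text \<open>The comparison of heights will be raised to the power \<open>\<mu>\<close>, and
  \<open>\<mu> < d < m\<close>; hence the exponent \<open>m\<close>.\<close>

definition b_total :: "nat \<Rightarrow> nat" where
  "b_total m = b_gap m + b_small m + b_end m * b_height m ^ m"

locale approximation_setting = padic_field p abs_p
  for p :: nat and abs_p :: "'a::field_char_0 \<Rightarrow> real" +
  fixes \<alpha> \<beta> :: 'a and b :: "rat poly" and m :: nat
  assumes algebraic: "algebraic \<alpha>"
    and degree_ge: "3 \<le> alg_degree \<alpha>"
    and degree_b: "degree b < alg_degree \<alpha>"
    and beta_eq: "\<beta> = ev b \<alpha>"
    and irrational: "\<beta> \<notin> \<rat>"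
    and code_alpha: "rat_poly_code (min_poly \<alpha>) \<le> m"
    and code_beta: "rat_poly_code b \<le> m"
begin

abbreviation d :: nat where "d \<equiv> alg_degree \<alpha>"

definition F :: "rat poly" where "F = smult (fact m) (min_poly \<alpha>)"

lemma min_poly_nonzero: "min_poly \<alpha> \<noteq> 0"
  using degree_ge by (auto simp: alg_degree_def)

lemma degree_less_m: "d < m"
  using degree_less_rat_poly_code[OF min_poly_nonzero] code_alpha by (simp add: alg_degree_def)

lemma F: "int_bounded (fact m * m) F" "degree F = d" "coeff F d = fact m" "ev F \<alpha> = 0" "F \<noteq> 0"
  using min_poly[OF algebraic] min_poly_nonzero int_bounded_clear_denominators[OF code_alpha]
  by (simp_all add: F_def alg_degree_def ev_smult)

lemma dvd_if_root: "ev P \<alpha> = 0 \<Longrightarrow> F dvd P"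
  using irreducible_dvd_if_root[of "min_poly \<alpha>" \<alpha> P] min_poly[OF algebraic]
  by (simp add: F_def smult_dvd_iff)

lemma ev_nonzero: "P \<noteq> 0 \<Longrightarrow> degree P < d \<Longrightarrow> ev P \<alpha> \<noteq> 0"
  using dvd_if_root[of P] dvd_imp_degree_le[of F P] F(2) by auto

text \<open>A rational zero would split a linear factor off an irreducible polynomial of degree at
  least 3.\<close>

lemma poly_F_nonzero: "poly F q \<noteq> 0"
proof
  assume "poly F q = 0"
  then have "[:- q, 1:] dvd min_poly \<alpha>" by (simp add: F_def poly_eq_0_iff_dvd)
  then obtain g where g: "min_poly \<alpha> = [:- q, 1:] * g" by blast
  moreover have "\<not> [:- q, 1:] dvd 1" by (simp add: is_unit_iff_degree)
  ultimately have "g dvd 1" using min_poly(2)[OF algebraic] irreducibleD by blast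
  then have "degree g = 0" using is_unit_iff_degree[of g] by (metis dvd_0_left_iff zero_neq_one)
  then have "degree (min_poly \<alpha>) \<le> 1" unfolding g using degree_mult_le[of "[:- q, 1:]" g] by simp
  then show False using degree_ge by (simp add: alg_degree_def)
qed

text \<open>Isolating the leading term of \<open>F\<close> expresses
  \<open>fact m * \<alpha> ^ d\<close> by an integral polynomial \<open>G\<close> of smaller degree.
  If \<open>\<alpha>\<close> has size above 1, this gives
  \<open>abs_p (fact m) * abs_p \<alpha> \<le> 1\<close>.\<close>

lemma abs_alpha_le: "abs_p \<alpha> \<le> fact m"
proof (cases "abs_p \<alpha> \<le> 1")
  case True
  then show ?thesis using fact_ge_1[of m, where ?'a = real] by linarith
next
  case False
  define G where "G = F - monom (fact m) d"
  have G: "degree G \<le> d - 1"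
  proof -
    have "coeff G i = 0" if "i \<ge> d" for i
      using that F(2,3) by (cases "i = d") (simp_all add: G_def coeff_eq_0)
    then have "degree G < d" using degree_ge by (intro degree_less_if_coeffs_0) simp_all
    then show ?thesis by simp
  qed
  have "int_bounded (fact m * m + fact m) G"
    unfolding G_def using int_bounded_monom[of "fact m" "fact m" d]
    by (intro int_bounded_diff F(1)) simp
  then have "abs_p (ev G \<alpha>) \<le> abs_p \<alpha> ^ (d - 1)"
    using False G by (intro abs_ev_le) auto
  moreover have "ev (monom (fact m) d) \<alpha> = fact m * \<alpha> ^ d"
    by (simp add: map_poly_monom poly_monom of_rat_fact)
  then have "ev G \<alpha> = - (fact m * \<alpha> ^ d)" unfolding G_def ev_diff F(4) by simp
  ultimately have "abs_p (fact m) * abs_p \<alpha> * abs_p \<alpha> ^ (d - 1) \<le> 1 * abs_p \<alpha> ^ (d - 1)"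
    using degree_ge power_Suc[of "abs_p \<alpha>" "d - 1"] by (simp add: abs_minus abs_mult abs_power mult.assoc)
  then have *: "abs_p (fact m) * abs_p \<alpha> \<le> 1"
    using False by (subst (asm) mult_le_cancel_right) auto
  have "1 / fact m \<le> abs_p (fact m)"
    using abs_of_int_ge[of "fact m"] by simp
  then have "1 / fact m * abs_p \<alpha> \<le> 1"
    using * mult_right_mono[OF _ abs_nonneg[of \<alpha>]] order_trans by blast
  then show ?thesis by (simp add: divide_le_eq)
qed

lemma b_coeff_ge_1: "1 \<le> b_coeff m"
  using degree_less_m by (simp add: b_coeff_def Suc_le_eq)

section \<open>Pairs of polynomials whose quotient at \<open>\<alpha>\<close> is
  \<open>\<beta>\<close>\<close>

definition Bt :: "rat poly" where "Bt = smult (fact m) b"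

text \<open>A relation among these three with multipliers \<open>X 0\<close>, \<open>X 1\<close>,
  \<open>X 2\<close> says that \<open>F\<close> times \<open>X 2\<close> is \<open>fact m\<close>
  times \<open>X 0 - b * X 1\<close>, so that \<open>X 0\<close> and \<open>\<beta>\<close> times
  \<open>X 1\<close> agree at \<open>\<alpha>\<close>.\<close>

definition relation_polys :: "nat \<Rightarrow> rat poly" where
  "relation_polys t = (if t = 0 then [:fact m:] else if t = 1 then - Bt else - F)"

lemma relation_polys_bounded: "int_bounded (b_coeff m) (relation_polys t)"
proof -
  have "int_bounded (b_coeff m) (monom (of_int (fact m)) 0)"
    using degree_less_m by (intro int_bounded_monom) (auto simp: b_coeff_def)
  then show ?thesis
    unfolding relation_polys_def Bt_def
    using F(1) int_bounded_clear_denominators[OF code_beta]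
    by (auto intro!: int_bounded_uminus simp: b_coeff_def monom_0)
qed

lemma relation_sum:
  "(\<Sum>t<3. X t * relation_polys t) = smult (fact m) (X 0 - b * X 1) - X 2 * F"
  unfolding sum_lessThan_3 relation_polys_def Bt_def
  by (simp add: smult_diff_right mult.commute)

lemma ev_relation:
  assumes "(\<Sum>t<3. X t * relation_polys t) = 0"
  shows "ev (X 0) \<alpha> = \<beta> * ev (X 1) \<alpha>"
proof -
  have "smult (fact m) (X 0 - b * X 1) = X 2 * F" using assms unfolding relation_sum by simp
  then have "ev (smult (fact m) (X 0 - b * X 1)) \<alpha> = 0" by (simp add: ev_mult F(4))
  then show ?thesis by (simp add: ev_smult ev_diff ev_mult beta_eq)
qed

definition represents :: "nat \<Rightarrow> rat poly \<Rightarrow> rat poly \<Rightarrow> bool" where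
  "represents k A B \<longleftrightarrow> (A \<noteq> 0 \<or> B \<noteq> 0) \<and> degree A \<le> k \<and> degree B \<le> k \<and> ev A \<alpha> = \<beta> * ev B \<alpha>"

lemma represents_relation:
  assumes "\<exists>t<3. X t \<noteq> 0" "(\<Sum>t<3. X t * relation_polys t) = 0"
    and "\<And>t i. t < 3 \<Longrightarrow> i \<ge> (if t = 2 then k else Suc k) \<Longrightarrow> coeff (X t) i = 0"
  shows "represents k (X 0) (X 1)"
proof -
  have "X 0 \<noteq> 0 \<or> X 1 \<noteq> 0"
  proof (rule ccontr)
    assume *: "\<not> ?thesis"
    then have "X 2 = 0" using assms(2) F(5) unfolding relation_sum by simp
    moreover have "t = 0 \<or> t = 1 \<or> t = 2" if "t < 3" for t :: nat using that by linarith
    ultimately show False using * assms(1) by metis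
  qed
  moreover have "degree (X 0) < Suc k" "degree (X 1) < Suc k"
    using assms(3)[of 0] assms(3)[of 1] by (auto intro!: degree_less_if_coeffs_0 simp del: less_Suc_eq_le)
  ultimately show ?thesis using ev_relation[OF assms(2)] by (simp add: represents_def)
qed

text \<open>For \<open>k = d div 2\<close> there are \<open>3 * k + 2\<close> unknowns and only
  \<open>k + d\<close> equations, since \<open>d < 2 * k + 2\<close>.\<close>

lemma represents_half: "\<exists>A B. represents (d div 2) A B"
proof -
  let ?k = "d div 2"
  define n where "n t = (if t = 2 then ?k else Suc ?k)" for t :: nat
  have n: "(\<Sum>t<3. n t) = 3 * ?k + 2" unfolding sum_lessThan_3 by (simp add: n_def)
  have deg: "coeff (monom 1 j * relation_polys t) i = 0" if "t < 3" "j < n t" "i \<ge> ?k + d" for t j i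
  proof -
    have "coeff [:fact m:] (i - j) = (0 :: rat)" if "t \<noteq> 2"
      using that \<open>j < n t\<close> \<open>i \<ge> ?k + d\<close> degree_ge by (intro coeff_eq_0) (auto simp: n_def)
    moreover have "coeff b (i - j) = 0" if "t \<noteq> 2"
      using that \<open>j < n t\<close> \<open>i \<ge> ?k + d\<close> degree_b by (intro coeff_eq_0) (auto simp: n_def)
    moreover have "coeff F (i - j) = 0" if "t = 2"
      using that \<open>j < n t\<close> \<open>i \<ge> ?k + d\<close> F(2) by (intro coeff_eq_0) (auto simp: n_def)
    ultimately show ?thesis
      using \<open>t < 3\<close> by (auto simp: coeff_monom_mult relation_polys_def Bt_def)
  qed
  have "\<exists>X. (\<exists>t<3. X t \<noteq> 0) \<and>
      (\<forall>t<3. (\<forall>i\<ge>n t. coeff (X t) i = 0) \<and> int_bounded (solution_bound (\<Sum>t<3. n t) (b_coeff m)) (X t)) \<and>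
      (\<Sum>t<3. X t * relation_polys t) = 0"
  proof (intro small_poly_relation b_coeff_ge_1 relation_polys_bounded disjI1 exI[of _ "?k + d"] conjI)
    show "?k + d < (\<Sum>t<3. n t)" unfolding n by linarith
  qed (use deg in blast)
  then obtain X where "\<exists>t<3. X t \<noteq> 0" "\<And>t i. t < 3 \<Longrightarrow> i \<ge> n t \<Longrightarrow> coeff (X t) i = 0"
    "(\<Sum>t<3. X t * relation_polys t) = 0" by blast
  then have "represents ?k (X 0) (X 1)" unfolding n_def by (intro represents_relation) blast+
  then show ?thesis by blast
qed

text \<open>For small \<open>k\<close> there may be more equations than unknowns, but the given pair
  is itself a rational solution. Elimination turns it into one whose size depends on
  \<open>m\<close> alone.\<close>

lemma represents_bounded:
  assumes "represents k A B" "1 \<le> k" "2 * k \<le> d"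
  obtains A' B' where "represents k A' B'" "int_bounded (b_AB m) A'" "int_bounded (b_AB m) B'"
proof -
  define n where "n t = (if t = 2 then k else Suc k)" for t :: nat
  have n: "(\<Sum>t<3. n t) = 3 * k + 2" unfolding sum_lessThan_3 by (simp add: n_def)
  have "ev A \<alpha> = \<beta> * ev B \<alpha>" using assms(1) by (simp add: represents_def)
  then have "ev (smult (fact m) (A - b * B)) \<alpha> = 0"
    by (simp add: ev_smult ev_diff ev_mult beta_eq)
  \<comment> \<open>The quotient by \<open>F\<close> is the third multiplier of a relation;
    comparing degrees shows that its degree is below \<open>k\<close>.\<close>
  then obtain Q where Q: "smult (fact m) (A - b * B) = F * Q" using dvd_if_root by blast
  have Q0: "coeff Q i = 0" if "i \<ge> k" for i
  proof (cases "Q = 0")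
    case False
    have "degree (b * B) \<le> degree b + degree B" by (rule degree_mult_le)
    then have "degree (A - b * B) < k + d"
      using assms degree_b by (intro le_less_trans[OF degree_diff_le_max]) (auto simp: represents_def)
    then have "degree (F * Q) < k + d" unfolding Q[symmetric] by simp
    then have "degree Q < k" using False F by (simp add: degree_mult_eq)
    then show ?thesis using that by (intro coeff_eq_0) simp
  qed simp
  define X where "X t = (if t = 0 then A else if t = 1 then B else Q)" for t :: nat
  have X_sum: "(\<Sum>t<3. X t * relation_polys t) = 0"
    unfolding relation_sum using Q by (simp add: X_def mult.commute)
  have X_coeff: "coeff (X t) i = 0" if "i \<ge> n t" for t i
    using that assms(1) Q0 by (auto simp: X_def n_def represents_def coeff_eq_0 split: if_splits)
  have X_nonzero: "X 0 \<noteq> 0 \<or> X 1 \<noteq> 0" using assms(1) by (simp add: X_def represents_def)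
  have "\<exists>X. (\<exists>t<3. X t \<noteq> 0) \<and>
      (\<forall>t<3. (\<forall>i\<ge>n t. coeff (X t) i = 0) \<and> int_bounded (solution_bound (\<Sum>t<3. n t) (b_coeff m)) (X t)) \<and>
      (\<Sum>t<3. X t * relation_polys t) = 0"
  proof (intro small_poly_relation b_coeff_ge_1 relation_polys_bounded disjI2 exI[of _ X] conjI)
    show "\<exists>t<3. X t \<noteq> 0" using X_nonzero
      by (metis zero_less_numeral one_less_numeral_iff semiring_norm(77))
  qed (use X_sum X_coeff in blast)+
  then obtain Y where Y: "\<exists>t<3. Y t \<noteq> 0" "\<And>t i. t < 3 \<Longrightarrow> i \<ge> n t \<Longrightarrow> coeff (Y t) i = 0"
    "\<And>t. t < 3 \<Longrightarrow> int_bounded (solution_bound (3 * k + 2) (b_coeff m)) (Y t)"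
    "(\<Sum>t<3. Y t * relation_polys t) = 0" unfolding n by blast
  have "represents k (Y 0) (Y 1)" using Y(1,2,4) unfolding n_def by (intro represents_relation) blast+
  moreover have *: "solution_bound (3 * k + 2) (b_coeff m) \<le> b_AB m"
    unfolding b_AB_def using assms(2,3) degree_less_m by (intro solution_bound_mono) simp_all
  moreover have "int_bounded (b_AB m) (Y 0)" "int_bounded (b_AB m) (Y 1)"
    by (rule int_bounded_mono[OF Y(3) *], simp)+
  ultimately show thesis using that by blast
qed

text \<open>As \<open>k < d\<close>, no nonzero polynomial of degree at most \<open>k\<close>
  vanishes at \<open>\<alpha>\<close>; and constants \<open>A\<close>, \<open>B\<close> would make
  \<open>\<beta>\<close> rational.\<close>

lemma represents_degree_B:
  assumes "represents k A B" "2 * k \<le> d"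
  shows "B \<noteq> 0" "ev B \<alpha> \<noteq> 0" "ev A \<alpha> \<noteq> 0" "1 \<le> k"
proof -
  have k: "k < d" using assms(2) degree_ge by linarith
  have AB: "A \<noteq> 0 \<or> B \<noteq> 0" "degree A \<le> k" "degree B \<le> k" "ev A \<alpha> = \<beta> * ev B \<alpha>"
    using assms(1) by (auto simp: represents_def)
  show "B \<noteq> 0"
  proof
    assume "B = 0"
    then have "A \<noteq> 0" "ev A \<alpha> = 0" using AB by auto
    then show False using ev_nonzero[of A] AB(2) k by simp
  qed
  then show B: "ev B \<alpha> \<noteq> 0" using ev_nonzero[of B] AB(3) k by simp
  have "\<beta> \<noteq> 0" using irrational by auto
  then show "ev A \<alpha> \<noteq> 0" using B AB(4) by simp
  show "1 \<le> k"
  proof (rule ccontr)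
    assume "\<not> 1 \<le> k"
    then obtain a c where "A = [:a:]" "B = [:c:]" using AB(2,3) degree_eq_zeroE by (metis le_zero_eq less_one not_le)
    then have "\<beta> = of_rat a / of_rat c" using AB(4) B by (simp add: map_poly_pCons field_simps)
    then have "\<beta> = of_rat (a / c)" by (simp add: of_rat_divide)
    then show False using irrational by (metis Rats_of_rat)
  qed
qed

text \<open>For the least possible \<open>k\<close>, cancelling a common factor, or both degrees
  being below \<open>k\<close>, would give a pair for a smaller \<open>k\<close>.\<close>

lemma ex_minimal_pair:
  obtains k A B where "represents k A B" "2 * k \<le> d" "coprime A B" "degree A = k \<or> degree B = k"
    "int_bounded (b_AB m) A" "int_bounded (b_AB m) B"
proof -
  define k where "k = (LEAST k. \<exists>A B. represents k A B)"
  have ex: "\<exists>A B. represents k A B" unfolding k_def using represents_half by (rule LeastI)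
  have "k \<le> d div 2" unfolding k_def using represents_half by (rule Least_le)
  then have k: "2 * k \<le> d" by simp
  have least: "k \<le> k'" if "represents k' A B" for k' A B
    unfolding k_def using that by (intro Least_le) blast
  obtain A0 B0 where AB0: "represents k A0 B0" using ex by blast
  \<comment> \<open>The pair with bounded coefficients belongs to the same \<open>k\<close>, so
    minimality applies to it as well.\<close>
  obtain A B where AB: "represents k A B" "int_bounded (b_AB m) A" "int_bounded (b_AB m) B"
    by (rule represents_bounded[OF AB0 represents_degree_B(4)[OF AB0 k] k])
  have "degree A = k \<or> degree B = k"
  proof (rule ccontr)
    assume "\<not> ?thesis"
    then have "represents (k - 1) A B" using AB(1) by (auto simp: represents_def)
    then show False using least represents_degree_B(4)[OF AB(1) k] by fastforce
  qed
  moreover have "coprime A B"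
  proof (rule ccontr)
    assume "\<not> coprime A B"
    then obtain G where G: "G dvd A" "G dvd B" "\<not> G dvd 1" by (auto elim: not_coprimeE)
    then obtain A1 B1 where A1: "A = G * A1" "B = G * B1" by blast
    have B: "B \<noteq> 0" using represents_degree_B(1)[OF AB(1) k] .
    then have "G \<noteq> 0" "B1 \<noteq> 0" using A1 by auto
    then have deg_G: "degree G \<noteq> 0" using G(3) by (simp add: is_unit_iff_degree)
    have "degree B = degree G + degree B1" unfolding A1 using \<open>G \<noteq> 0\<close> \<open>B1 \<noteq> 0\<close> by (rule degree_mult_eq)
    moreover have "degree A1 \<le> k - degree G"
      using AB(1) \<open>G \<noteq> 0\<close> A1(1) by (cases "A1 = 0") (auto simp: represents_def degree_mult_eq)
    moreover have "ev G \<alpha> \<noteq> 0" using represents_degree_B(2)[OF AB(1) k] unfolding A1 ev_mult by simp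
    then have "ev A1 \<alpha> = \<beta> * ev B1 \<alpha>" using AB(1) by (simp add: represents_def A1 ev_mult)
    ultimately have "represents (k - degree G) A1 B1"
      using AB(1) \<open>B1 \<noteq> 0\<close> by (auto simp: represents_def)
    then show False using least deg_G represents_degree_B(4)[OF AB(1) k] by fastforce
  qed
  ultimately show thesis using that AB k by blast
qed

end

section \<open>Diophantine estimates\<close>

text \<open>Horner's scheme for forms: a form of degree \<open>k\<close> is \<open>c * y ^ k\<close>
  plus \<open>x\<close> times one of degree \<open>k - 1\<close>, and each coefficient contributes
  at most \<open>L\<close> times the \<open>k\<close>-th power of the height.\<close>

lemma homogenized_value:
  fixes x y :: int
  assumes "int_bounded L P" "degree P \<le> k" "y \<noteq> 0"
  obtains z :: int where "of_int z = of_int y ^ k * poly P (of_int x / of_int y)"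
    "\<bar>real_of_int z\<bar> \<le> real ((k + 1) * L) * height x y ^ k"
proof -
  let ?H = "max \<bar>x\<bar> \<bar>y\<bar>"
  have "\<exists>z :: int. of_int z = of_int y ^ k * poly P (of_int x / of_int y) \<and>
      \<bar>z\<bar> \<le> int ((k + 1) * L) * ?H ^ k"
    using assms(1,2)
  proof (induction P arbitrary: k)
    case 0
    then show ?case by (intro exI[of _ 0]) simp
  next
    case (pCons a P)
    obtain c :: int where c: "a = of_int c" "\<bar>c\<bar> \<le> int L" and P: "int_bounded L P"
      using pCons.prems(1) by (auto simp: int_bounded_pCons)
    have cy: "\<bar>c * y ^ k\<bar> \<le> int L * ?H ^ k"
      unfolding abs_mult power_abs using c(2) by (intro mult_mono power_mono) auto
    show ?case
    proof (cases "P = 0")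
      case True
      have "\<bar>c * y ^ k\<bar> \<le> int ((k + 1) * L) * ?H ^ k"
        using cy by (rule order_trans) (intro mult_right_mono, auto)
      with True show ?thesis by (intro exI[of _ "c * y ^ k"]) (simp add: c mult.commute)
    next
      case False
      then obtain k' where k': "k = Suc k'" "degree P \<le> k'" using pCons.prems(2) by (cases k) auto
      obtain z where z: "of_int z = of_int y ^ k' * poly P (of_int x / of_int y)"
        "\<bar>z\<bar> \<le> int ((k' + 1) * L) * ?H ^ k'"
        using pCons.IH[OF P k'(2)] by blast
      have "\<bar>x * z\<bar> \<le> ?H * (int ((k' + 1) * L) * ?H ^ k')"
        unfolding abs_mult using z(2) by (intro mult_mono) auto
      then have "\<bar>c * y ^ k + x * z\<bar> \<le> int L * ?H ^ k + ?H * (int ((k' + 1) * L) * ?H ^ k')"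
        using cy by linarith
      also have "\<dots> = int ((k + 1) * L) * ?H ^ k" by (simp add: k' algebra_simps)
      finally have "\<bar>c * y ^ k + x * z\<bar> \<le> int ((k + 1) * L) * ?H ^ k" .
      moreover have "of_int (c * y ^ k + x * z) =
          of_int y ^ k * poly (pCons a P) (of_int x / of_int y)"
        using assms(3) by (simp add: z(1) c(1) k'(1) distrib_left mult.commute)
      ultimately show ?thesis by blast
    qed
  qed
  then obtain z where z: "of_int z = of_int y ^ k * poly P (of_int x / of_int y)"
    "\<bar>z\<bar> \<le> int ((k + 1) * L) * ?H ^ k" by blast
  have "real_of_int \<bar>z\<bar> \<le> real_of_int (int ((k + 1) * L) * ?H ^ k)"
    using z(2) by (simp only: of_int_le_iff)
  with z(1) that show thesis by (simp add: height_def)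
qed

lemma height_bounds:
  "\<bar>real_of_int x\<bar> \<le> height x y" "\<bar>real_of_int y\<bar> \<le> height x y" "y \<noteq> 0 \<Longrightarrow> 1 \<le> height x y"
  by (auto simp: height_def)

lemma height_nonneg: "0 \<le> height x y"
  by (simp add: height_def)

lemma abs_mult_diff_le: "\<bar>a * b - c * e\<bar> \<le> \<bar>a\<bar> * \<bar>b\<bar> + \<bar>c\<bar> * \<bar>e\<bar>" for a b c e :: real
  by (metis abs_mult abs_triangle_ineq4)

context approximation_setting
begin

definition M :: real where "M = fact m"

lemma M_ge_1: "1 \<le> M"
  by (simp add: M_def)

lemma abs_alpha_le_M: "abs_p \<alpha> \<le> M"
  using abs_alpha_le by (simp add: M_def)

lemma m_ge_1: "1 \<le> m"
  using degree_less_m by simp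

lemma b_AB_ge_1: "1 \<le> b_AB m"
  unfolding b_AB_def using m_ge_1 b_coeff_ge_1 by (intro solution_bound_ge_1) simp_all

lemma b_bez_ge_1: "1 \<le> b_bez m"
  unfolding b_bez_def using m_ge_1 b_AB_ge_1 by (intro solution_bound_ge_1) simp_all

lemma b_W_ge: "b_coeff m \<le> b_W m"
  by (simp add: b_W_def)

lemma b_low_ge_1: "1 \<le> b_low m"
  unfolding b_low_def using m_ge_1 b_coeff_ge_1 b_W_ge by (intro solution_bound_ge_1) linarith+

lemma M_power_le: "i \<le> i' \<Longrightarrow> M ^ i \<le> M ^ i'"
  using M_ge_1 by (rule power_increasing[rotated])

section \<open>Lower bound for the Wronskian at \<open>\<alpha>\<close>\<close>

definition wronskian :: "rat poly \<Rightarrow> rat poly \<Rightarrow> rat poly" where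
  "wronskian A B = pderiv A * B - A * pderiv B"

text \<open>The Wronskian has degree at most \<open>2 * k - 1 < d\<close>, so it is coprime to the
  irreducible \<open>F\<close>. A small Bezout relation at \<open>\<alpha>\<close> reads
  \<open>V(\<alpha>) * W(\<alpha>) = r\<close> with a nonzero integer \<open>r\<close>, and
  \<open>V(\<alpha>)\<close> has size at most \<open>M ^ d\<close>.\<close>

lemma abs_wronskian_ge:
  assumes "2 * k \<le> d" "1 \<le> k" "coprime A B" "degree A \<le> k" "degree B \<le> k" "degree A = k \<or> degree B = k"
    and "int_bounded (b_AB m) A" "int_bounded (b_AB m) B"
  shows "1 / (real (b_low m) * M ^ d) \<le> abs_p (ev (wronskian A B) \<alpha>)"
proof -
  let ?W = "wronskian A B"
  have W0: "?W \<noteq> 0"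
    using coprime_wronskian_nonzero[OF assms(3)] assms(2,6) by (auto simp: wronskian_def)
  have "degree (pderiv A * B) \<le> degree (pderiv A) + degree B" "degree (A * pderiv B) \<le> degree A + degree (pderiv B)"
    by (rule degree_mult_le)+
  then have degs: "degree (pderiv A * B) < d" "degree (A * pderiv B) < d"
    using assms(1,2,4,5) by (simp_all add: degree_pderiv)
  then have deg_W: "degree ?W < d" unfolding wronskian_def by (rule degree_diff_less)
  have k_m: "k \<le> m" using assms(1) degree_less_m by simp
  have dA: "degree A \<le> m" "degree B \<le> m" "degree (pderiv A) \<le> m"
    using assms(4,5) k_m by (simp_all add: degree_pderiv)
  have bdd_W: "int_bounded (b_W m) ?W"
    unfolding wronskian_def
    by (rule int_bounded_mono[OF int_bounded_diff[OF
          int_bounded_mult[OF int_bounded_pderiv[OF assms(7) dA(1)] assms(8) dA(3)]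
          int_bounded_mult[OF assms(7) int_bounded_pderiv[OF assms(8) dA(2)] dA(1)]]])
       (simp add: b_W_def)
  have "F = [:fact m:] * min_poly \<alpha>" by (simp add: F_def)
  moreover have "is_unit [:fact m :: rat:]" by (simp add: is_unit_const_poly_iff dvd_field_iff)
  ultimately have "irreducible F"
    using irreducible_mult_unit_left min_poly(2)[OF algebraic] by metis
  moreover have "\<not> F dvd ?W"
    using W0 deg_W dvd_imp_degree_le[of F ?W] F(2) by auto
  ultimately have "coprime F ?W"
    by (intro prime_elem_imp_coprime field_poly_irreducible_imp_prime)
  moreover have "1 \<le> d" using degree_ge by simp
  moreover have "1 \<le> b_W m" using b_W_ge b_coeff_ge_1 by linarith
  moreover have "int_bounded (b_W m) F"
    using int_bounded_mono[OF F(1)] b_W_ge by (simp add: b_coeff_def)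
  ultimately have conds: "coprime F ?W" "1 \<le> d" "1 \<le> b_W m" "int_bounded (b_W m) F" by blast+
  obtain U V and r :: int where UV: "U * F + V * ?W = monom (of_int r) 0" "r \<noteq> 0"
    "degree V < d" "int_bounded (solution_bound (2 * d + 1) (b_W m)) V" "\<bar>r\<bar> \<le> int (solution_bound (2 * d + 1) (b_W m))"
    by (rule small_bezout_relation[of F ?W d 0 "b_W m"])
       (use conds F(2) deg_W bdd_W degree_ge in \<open>auto simp del: One_nat_def\<close>)
  have "ev V \<alpha> * ev ?W \<alpha> = of_int r"
    using arg_cong[OF UV(1), of "\<lambda>P. ev P \<alpha>"] by (simp add: ev_add ev_mult F(4) monom_0 ev_const)
  then have r: "abs_p (ev V \<alpha>) * abs_p (ev ?W \<alpha>) = abs_p (of_int r)" by (metis abs_mult)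
  have "solution_bound (2 * d + 1) (b_W m) \<le> b_low m"
    unfolding b_low_def using degree_less_m by (intro solution_bound_mono) simp_all
  then have "\<bar>r\<bar> \<le> int (b_low m)" using UV(5) by linarith
  then have "real_of_int \<bar>r\<bar> \<le> real (b_low m)" by linarith
  then have "1 / real (b_low m) \<le> 1 / real_of_int \<bar>r\<bar>" using UV(2) by (intro divide_left_mono) auto
  also have "\<dots> \<le> abs_p (of_int r)" using UV(2) by (rule abs_of_int_ge)
  also have "\<dots> \<le> M ^ d * abs_p (ev ?W \<alpha>)"
    unfolding r[symmetric] using UV(3)
    by (intro mult_right_mono abs_nonneg abs_ev_le[OF UV(4) _ abs_alpha_le_M M_ge_1]) simp
  finally show ?thesis
    using M_ge_1 b_low_ge_1 by (simp add: field_simps)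
qed

end

section \<open>Estimates for a fixed pair \<open>A, B\<close> and two approximations\<close>

locale approximation_pair = approximation_setting +
  fixes k :: nat and A B :: "rat poly" and x1 y1 x2 y2 :: int
  assumes pair: "represents k A B" "2 * k \<le> d" "coprime A B" "degree A = k \<or> degree B = k"
    "int_bounded (b_AB m) A" "int_bounded (b_AB m) B"
    and y1: "y1 \<noteq> 0" "coprime x1 y1" and y2: "y2 \<noteq> 0" "coprime x2 y2"
    and close: "abs_p (of_int y1 * \<alpha> - of_int x1) < 1 / real (b_small m)"
begin

definition q :: rat where "q = of_int x1 / of_int y1"
definition \<xi> :: 'a where "\<xi> = of_rat q"

abbreviation "\<delta>\<^sub>1 \<equiv> abs_p (of_int y1 * \<alpha> - of_int x1)"
abbreviation "\<delta>\<^sub>2 \<equiv> abs_p (of_int y2 * \<beta> - of_int x2)"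
abbreviation "H\<^sub>1 \<equiv> height x1 y1"
abbreviation "H\<^sub>2 \<equiv> height x2 y2"

lemma degrees: "degree A \<le> k" "degree B \<le> k" "ev A \<alpha> = \<beta> * ev B \<alpha>" "1 \<le> k" "k \<le> m"
  using pair(1,2) represents_degree_B(4) degree_less_m by (auto simp: represents_def)

lemma xi: "of_int y1 * (\<xi> - \<alpha>) = - (of_int y1 * \<alpha> - of_int x1)"
  using y1 by (simp add: \<xi>_def q_def of_rat_divide algebra_simps)

text \<open>If \<open>y1\<close> is divisible by \<open>p\<close>, then \<open>x1\<close> has
  absolute value 1, and \<open>x1\<close> being close to \<open>y1 * \<alpha>\<close> keeps
  \<open>y1\<close> from being small. This permits division by \<open>y1\<close> at the cost of a
  factor \<open>2 * M\<close>.\<close>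

lemma abs_y1: "abs_p (of_int y1) \<le> 1" "1 / (2 * M) \<le> abs_p (of_int y1)"
proof -
  show "abs_p (of_int y1) \<le> 1" by (rule abs_of_int_le_1)
  have "real (b_small m) \<ge> 2"
  proof -
    have "1 \<le> fact m ^ (3 * m + 1) * b_low m" using b_low_ge_1 by (simp add: Suc_le_eq)
    then have "4 * 1 \<le> b_small m" unfolding b_small_def mult.assoc by (rule mult_le_mono2)
    then show ?thesis by simp
  qed
  then have "\<delta>\<^sub>1 \<le> 1 / 2" using close by (intro less_imp_le[OF less_le_trans[OF close]]) (simp add: divide_simps)
  show "1 / (2 * M) \<le> abs_p (of_int y1)"
  proof (cases "abs_p (of_int y1) = 1")
    case True
    have "1 \<le> 2 * M" using M_ge_1 by linarith
    with True show ?thesis by simp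
  next
    case False
    then have "1 = abs_p (of_int x1)" using abs_coprime[OF y1(2)] by simp
    also have "of_int x1 = of_int y1 * \<alpha> + - (of_int y1 * \<alpha> - of_int x1)" by simp
    also have "abs_p \<dots> \<le> abs_p (of_int y1) * abs_p \<alpha> + \<delta>\<^sub>1"
      using abs_add_le[of "of_int y1 * \<alpha>" "- (of_int y1 * \<alpha> - of_int x1)"]
      unfolding abs_minus abs_mult .
    also have "\<dots> \<le> abs_p (of_int y1) * M + 1 / 2"
      using \<open>\<delta>\<^sub>1 \<le> 1 / 2\<close> by (intro add_mono mult_left_mono abs_alpha_le_M abs_nonneg)
    finally show ?thesis using M_ge_1 by (simp add: divide_le_eq)
  qed
qed

lemma abs_xi_diff: "abs_p (of_int y1) * abs_p (\<xi> - \<alpha>) = \<delta>\<^sub>1" "abs_p (\<xi> - \<alpha>) \<le> 2 * M * \<delta>\<^sub>1"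
proof -
  show *: "abs_p (of_int y1) * abs_p (\<xi> - \<alpha>) = \<delta>\<^sub>1"
    unfolding abs_mult[symmetric] xi abs_minus ..
  have "1 / (2 * M) * abs_p (\<xi> - \<alpha>) \<le> \<delta>\<^sub>1"
    unfolding *[symmetric] by (intro mult_right_mono abs_y1 abs_nonneg)
  then show "abs_p (\<xi> - \<alpha>) \<le> 2 * M * \<delta>\<^sub>1" using M_ge_1 by (simp add: field_simps)
qed

lemma abs_xi_diff_small:
  "abs_p (\<xi> - \<alpha>) \<le> 1 / (2 * M ^ (3 * m) * real (b_low m))"
proof -
  have b: "0 < real (b_low m)" using b_low_ge_1 by simp
  have "abs_p (\<xi> - \<alpha>) \<le> 2 * M * \<delta>\<^sub>1" by (rule abs_xi_diff)
  also have "\<dots> \<le> 2 * M * (1 / real (b_small m))"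
    using less_imp_le[OF close] M_ge_1 by (intro mult_left_mono) simp_all
  also have "\<dots> = 1 / (2 * M ^ (3 * m) * real (b_low m))"
  proof -
    \<comment> \<open>One factor \<open>2 * M\<close> in \<open>b_small\<close> was reserved for the
      division by \<open>y1\<close>.\<close>
    have bs: "real (b_small m) = 2 * M * (2 * M ^ (3 * m) * real (b_low m))"
      unfolding b_small_def M_def of_nat_mult of_nat_power of_nat_fact power_add power_one_right of_nat_numeral
      by (simp only: mult_ac)
    have cancel: "x * (1 / (x * y)) = 1 / y" if "x \<noteq> 0" for x y :: real using that by simp
    show ?thesis unfolding bs using M_ge_1 by (intro cancel) simp
  qed
  finally show ?thesis .
qed

lemma abs_xi_le: "abs_p \<xi> \<le> M"
proof -
  have "1 * 1 \<le> M ^ (3 * m) * real (b_low m)"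
    using M_ge_1 b_low_ge_1 by (intro mult_mono one_le_power) auto
  then have "1 \<le> 2 * M ^ (3 * m) * real (b_low m)" by linarith
  moreover have "1 / x \<le> 1" if "1 \<le> x" for x :: real using that by simp
  ultimately have "1 / (2 * M ^ (3 * m) * real (b_low m)) \<le> 1" by blast
  then have "abs_p (\<xi> - \<alpha>) \<le> M" using abs_xi_diff_small M_ge_1 by linarith
  then have "abs_p ((\<xi> - \<alpha>) + \<alpha>) \<le> M" using abs_alpha_le_M by (rule abs_add_le_bound)
  then show ?thesis by simp
qed

lemma homogenized:
  assumes "int_bounded L P" "degree P \<le> n"
  obtains z :: int where "of_int z = of_int y1 ^ n * poly P q" "of_int z = of_int y1 ^ n * ev P \<xi>"
    "\<bar>real_of_int z\<bar> \<le> real ((n + 1) * L) * H\<^sub>1 ^ n"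
proof -
  obtain z where z: "of_int z = of_int y1 ^ n * poly P q" "\<bar>real_of_int z\<bar> \<le> real ((n + 1) * L) * H\<^sub>1 ^ n"
    using homogenized_value[OF assms y1(1), of x1] unfolding q_def by blast
  have "(of_int z :: 'a) = of_rat (of_int z)" by simp
  also have "\<dots> = of_int y1 ^ n * ev P \<xi>"
    unfolding z(1) \<xi>_def ev_of_rat by (simp add: of_rat_mult of_rat_power)
  finally show thesis using that z by blast
qed

text \<open>One factor \<open>y1\<close> turns \<open>abs_p (\<xi> - \<alpha>)\<close> into
  \<open>\<delta>\<^sub>1\<close>; the remaining factors are at most 1 and are dropped.\<close>

lemma abs_homogenized_diff:
  assumes "int_bounded L P" "degree P \<le> n" "1 \<le> n"
  shows "abs_p (of_int y1) ^ n * abs_p (ev P \<xi> - ev P \<alpha>) \<le> \<delta>\<^sub>1 * M ^ n"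
proof -
  obtain n' where n': "n = Suc n'" using assms(3) by (cases n) auto
  have "abs_p (of_int y1) ^ n * abs_p (ev P \<xi> - ev P \<alpha>) \<le>
      abs_p (of_int y1) ^ n * (abs_p (\<xi> - \<alpha>) * M ^ n)"
    using abs_nonneg
    by (intro mult_left_mono abs_ev_diff_le[OF assms(1,2) abs_xi_le abs_alpha_le_M M_ge_1]) simp
  also have "\<dots> = abs_p (of_int y1) ^ n' * (\<delta>\<^sub>1 * M ^ n)"
    unfolding abs_xi_diff(1)[symmetric] n' by (simp add: mult_ac)
  also have "\<dots> \<le> 1 * (\<delta>\<^sub>1 * M ^ n)"
    using abs_nonneg abs_y1(1) M_ge_1 by (intro mult_right_mono power_le_one) auto
  finally show ?thesis by simp
qed

text \<open>The nonzero integer \<open>y2 * zA - x2 * zB\<close> has p-adic size at most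
  \<open>E * M ^ k\<close> and usual size at most a constant times
  \<open>H\<^sub>1 ^ k * H\<^sub>2\<close>; the product of the two sizes is at least 1.\<close>

lemma gap_if_unequal:
  assumes zA: "of_int zA = of_int y1 ^ k * ev A \<xi>" "\<bar>real_of_int zA\<bar> \<le> real ((k + 1) * b_AB m) * H\<^sub>1 ^ k"
    and zB: "of_int zB = of_int y1 ^ k * ev B \<xi>" "\<bar>real_of_int zB\<bar> \<le> real ((k + 1) * b_AB m) * H\<^sub>1 ^ k"
    and E: "\<delta>\<^sub>1 \<le> E" "\<delta>\<^sub>2 \<le> E"
    and unequal: "y2 * zA \<noteq> x2 * zB"
  shows "1 \<le> E * real (b_gap m) * H\<^sub>1 ^ k * H\<^sub>2"
proof -
  let ?N = "y2 * zA - x2 * zB"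
  let ?y = "of_int y1 ^ k :: 'a"
  have N0: "?N \<noteq> 0" using unequal by simp
  have E0: "0 \<le> E" using E(1) abs_nonneg order_trans by blast
  have y_le: "abs_p (of_int y1) ^ k \<le> 1" using abs_nonneg abs_y1(1) by (rule power_le_one)
  \<comment> \<open>Values at \<open>\<xi>\<close> are replaced by values at
    \<open>\<alpha>\<close>, where \<open>A(\<alpha>) = \<beta> * B(\<alpha>)\<close> leaves a
    multiple of \<open>y2 * \<beta> - x2\<close>.\<close>
  have eq: "of_int ?N = of_int y2 * (?y * (ev A \<xi> - ev A \<alpha>)) - of_int x2 * (?y * (ev B \<xi> - ev B \<alpha>))
      + (?y * ev B \<alpha>) * (of_int y2 * \<beta> - of_int x2)"
    by (simp add: zA(1) zB(1) degrees(3) algebra_simps)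
  have diff: "abs_p (of_int z * (?y * (ev P \<xi> - ev P \<alpha>))) \<le> E * M ^ k"
    if "int_bounded (b_AB m) P" "degree P \<le> k" for z P
  proof -
    have "abs_p (?y * (ev P \<xi> - ev P \<alpha>)) \<le> \<delta>\<^sub>1 * M ^ k"
      unfolding abs_mult abs_power by (rule abs_homogenized_diff[OF that degrees(4)])
    also have "\<dots> \<le> E * M ^ k" using E(1) M_ge_1 by (intro mult_right_mono) simp_all
    finally have "abs_p (?y * (ev P \<xi> - ev P \<alpha>)) \<le> E * M ^ k" .
    then have "abs_p (of_int z) * abs_p (?y * (ev P \<xi> - ev P \<alpha>)) \<le> 1 * (E * M ^ k)"
      using abs_of_int_le_1[of z] abs_nonneg by (intro mult_mono) auto
    then show ?thesis by (simp add: abs_mult)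
  qed
  have "abs_p ((?y * ev B \<alpha>) * (of_int y2 * \<beta> - of_int x2)) \<le> (1 * M ^ k) * E"
    unfolding abs_mult abs_power
    using y_le E(2) abs_ev_le[OF pair(6) degrees(2) abs_alpha_le_M M_ge_1] abs_nonneg M_ge_1
    by (intro mult_mono) auto
  then have "abs_p (of_int ?N) \<le> E * M ^ k"
    unfolding eq using diff[OF pair(5) degrees(1)] diff[OF pair(6) degrees(2)]
    by (intro abs_add_le_bound abs_diff_le_bound) (simp_all add: mult.commute)
  then have lower: "1 / \<bar>real_of_int ?N\<bar> \<le> E * M ^ k"
    using abs_of_int_ge[OF N0] by simp
  have "\<bar>real_of_int ?N\<bar> \<le> \<bar>real_of_int y2\<bar> * \<bar>real_of_int zA\<bar> + \<bar>real_of_int x2\<bar> * \<bar>real_of_int zB\<bar>"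
    unfolding of_int_diff of_int_mult by (rule abs_mult_diff_le)
  also have "\<dots> \<le> H\<^sub>2 * (real ((k + 1) * b_AB m) * H\<^sub>1 ^ k) + H\<^sub>2 * (real ((k + 1) * b_AB m) * H\<^sub>1 ^ k)"
    using zA(2) zB(2) height_bounds(1)[of x2 y2] height_bounds(2)[of y2 x2] height_bounds(3)[OF y2(1)]
    by (intro add_mono mult_mono) auto
  finally have upper: "\<bar>real_of_int ?N\<bar> \<le> 2 * real ((k + 1) * b_AB m) * H\<^sub>1 ^ k * H\<^sub>2"
    by (simp add: algebra_simps)
  have c: "real ((k + 1) * b_AB m) \<le> real ((m + 1) * b_AB m)"
    using degrees(5) by (intro of_nat_mono mult_le_mono1) simp
  have cancel: "1 / \<bar>x\<bar> * \<bar>x\<bar> = 1" if "x \<noteq> 0" for x :: real using that by simp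
  have "real_of_int ?N \<noteq> 0" using N0 unfolding of_int_eq_0_iff .
  then have "1 = 1 / \<bar>real_of_int ?N\<bar> * \<bar>real_of_int ?N\<bar>" using cancel by metis
  also have "\<dots> \<le> (E * M ^ k) * (2 * real ((k + 1) * b_AB m) * H\<^sub>1 ^ k * H\<^sub>2)"
    using lower upper E0 M_ge_1 by (intro mult_mono) auto
  also have "\<dots> \<le> (E * M ^ m) * (2 * real ((m + 1) * b_AB m) * H\<^sub>1 ^ k * H\<^sub>2)"
    using E0 M_ge_1 height_nonneg
    by (intro mult_mono mult_left_mono mult_right_mono M_power_le degrees(5) c
        mult_nonneg_nonneg zero_le_power of_nat_0_le_iff zero_le_numeral) simp_all
  also have "\<dots> = E * real (b_gap m) * H\<^sub>1 ^ k * H\<^sub>2" by (simp add: b_gap_def M_def mult_ac)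
  finally show "1 \<le> E * real (b_gap m) * H\<^sub>1 ^ k * H\<^sub>2" .
qed

text \<open>The Bezout relation \<open>U * A + V * B = r X^e\<close>, evaluated at
  \<open>x1 / y1\<close> and homogenized to the degree \<open>(k - 1) + k\<close>, shows that
  \<open>h\<close> divides a monomial in \<open>x1\<close>, \<open>y1\<close>; \<open>s\<close> is
  the cofactor.\<close>

lemma bezout_value:
  assumes zA: "of_int (h * x2) = of_int y1 ^ k * poly A q"
    and zB: "of_int (h * y2) = of_int y1 ^ k * poly B q"
    and e: "e < 2 * k"
  obtains r s :: int where "r \<noteq> 0" "\<bar>r\<bar> \<le> int (b_bez m)" "h * s = r * x1 ^ e * y1 ^ (2 * k - 1 - e)"
    "\<bar>real_of_int s\<bar> \<le> real (2 * m * b_bez m) * H\<^sub>1 ^ (k - 1) * H\<^sub>2"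
proof -
  let ?S = "solution_bound (2 * k + 1) (b_AB m)"
  have S: "?S \<le> b_bez m"
    unfolding b_bez_def using degrees(5) m_ge_1 by (intro solution_bound_mono) simp_all
  obtain U V and r :: int where UV: "U * A + V * B = monom (of_int r) e" "r \<noteq> 0"
    "degree U < k" "degree V < k" "int_bounded ?S U" "int_bounded ?S V" "\<bar>r\<bar> \<le> int ?S"
    by (rule small_bezout_relation[OF pair(3) degrees(1,2) pair(4) degrees(4) e b_AB_ge_1 pair(5,6)])
  have dUV: "degree U \<le> k - 1" "degree V \<le> k - 1" using UV(3,4) by simp_all
  obtain zU where zU: "of_int zU = of_int y1 ^ (k - 1) * poly U q"
    "\<bar>real_of_int zU\<bar> \<le> real ((k - 1 + 1) * ?S) * H\<^sub>1 ^ (k - 1)"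
    by (rule homogenized[OF UV(5) dUV(1)])
  obtain zV where zV: "of_int zV = of_int y1 ^ (k - 1) * poly V q"
    "\<bar>real_of_int zV\<bar> \<le> real ((k - 1 + 1) * ?S) * H\<^sub>1 ^ (k - 1)"
    by (rule homogenized[OF UV(6) dUV(2)])
  define s where "s = zU * x2 + zV * y2"
  have exps: "k - 1 + k = 2 * k - 1 - e + e" using e by simp
  have "of_int (h * s) = of_int zU * of_int (h * x2) + of_int zV * (of_int (h * y2) :: rat)"
    by (simp add: s_def algebra_simps)
  also have "\<dots> = of_int y1 ^ (k - 1 + k) * poly (U * A + V * B) q"
    unfolding zU(1) zV(1) zA zB power_add by (simp add: algebra_simps)
  also have "\<dots> = of_int r * of_int y1 ^ (2 * k - 1 - e) * (of_int y1 * q) ^ e"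
    unfolding UV(1) exps power_add poly_monom power_mult_distrib by (simp only: mult_ac)
  also have "of_int y1 * q = of_int x1" using y1 by (simp add: q_def)
  also have "of_int r * of_int y1 ^ (2 * k - 1 - e) * of_int x1 ^ e =
      (of_int (r * x1 ^ e * y1 ^ (2 * k - 1 - e)) :: rat)"
    by simp
  finally have hs: "h * s = r * x1 ^ e * y1 ^ (2 * k - 1 - e)" by (simp only: of_int_eq_iff)
  have "(k - 1 + 1) * ?S \<le> m * b_bez m" using degrees(4,5) S by (intro mult_le_mono) simp_all
  then have "real ((k - 1 + 1) * ?S) * H\<^sub>1 ^ (k - 1) \<le> real (m * b_bez m) * H\<^sub>1 ^ (k - 1)"
    by (intro mult_right_mono of_nat_mono zero_le_power height_nonneg)
  then have *: "\<bar>real_of_int zU\<bar> \<le> real (m * b_bez m) * H\<^sub>1 ^ (k - 1)"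
    "\<bar>real_of_int zV\<bar> \<le> real (m * b_bez m) * H\<^sub>1 ^ (k - 1)"
    using zU(2) zV(2) by linarith+
  have "\<bar>real_of_int s\<bar> \<le> \<bar>real_of_int zU\<bar> * \<bar>real_of_int x2\<bar> + \<bar>real_of_int zV\<bar> * \<bar>real_of_int y2\<bar>"
    using abs_mult_diff_le[of "real_of_int zU" "real_of_int x2" "- real_of_int zV" "real_of_int y2"]
    by (simp add: s_def)
  also have "\<dots> \<le> real (m * b_bez m) * H\<^sub>1 ^ (k - 1) * H\<^sub>2 + real (m * b_bez m) * H\<^sub>1 ^ (k - 1) * H\<^sub>2"
    using height_nonneg by (intro add_mono mult_mono * height_bounds) simp_all
  also have "\<dots> = real (2 * m * b_bez m) * H\<^sub>1 ^ (k - 1) * H\<^sub>2" by simp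
  finally have "\<bar>real_of_int s\<bar> \<le> real (2 * m * b_bez m) * H\<^sub>1 ^ (k - 1) * H\<^sub>2" .
  moreover have "\<bar>r\<bar> \<le> int (b_bez m)" using UV(7) S by linarith
  ultimately show thesis using that UV(2) hs by blast
qed

text \<open>Equality of the fractions gives \<open>zA = h * x2\<close> and
  \<open>zB = h * y2\<close>. The exponents \<open>0\<close> and \<open>2 * k - 1\<close> show that
  \<open>h\<close> divides \<open>r * y1 ^ (2 * k - 1)\<close> and
  \<open>r' * x1 ^ (2 * k - 1)\<close>, hence the bounded number \<open>r * r'\<close>. So little is
  cancelled that \<open>H\<^sub>2\<close> must be of order \<open>H\<^sub>1 ^ k\<close>.\<close>

lemma common_factor:
  assumes zA: "of_int zA = of_int y1 ^ k * poly A q"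
    and zB: "of_int zB = of_int y1 ^ k * poly B q"
    and eq: "y2 * zA = x2 * zB"
  obtains h :: int where "zA = h * x2" "zB = h * y2" "h \<noteq> 0" "H\<^sub>1 ^ k \<le> real (b_height m) * H\<^sub>2"
proof -
  have "y2 dvd x2 * zB" using eq by (metis dvd_triv_left)
  then have "y2 dvd zB" using y2(2) by (simp add: coprime_dvd_mult_right_iff coprime_commute)
  then obtain h where h: "zB = h * y2" by (metis dvd_div_mult_self)
  then have "y2 * zA = y2 * (h * x2)" using eq by (simp add: mult_ac)
  then have hA: "zA = h * x2" using y2(1) by simp
  have zA': "of_int (h * x2) = of_int y1 ^ k * poly A q" using zA hA by simp
  have zB': "of_int (h * y2) = of_int y1 ^ k * poly B q" using zB h by simp
  have k: "0 < 2 * k" "2 * k - 1 < 2 * k" using degrees(4) by simp_all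
  obtain r s where r: "r \<noteq> 0" "\<bar>r\<bar> \<le> int (b_bez m)" "h * s = r * x1 ^ 0 * y1 ^ (2 * k - 1 - 0)"
    "\<bar>real_of_int s\<bar> \<le> real (2 * m * b_bez m) * H\<^sub>1 ^ (k - 1) * H\<^sub>2"
    by (rule bezout_value[OF zA' zB' k(1)])
  obtain r' s' where r': "r' \<noteq> 0" "\<bar>r'\<bar> \<le> int (b_bez m)"
    "h * s' = r' * x1 ^ (2 * k - 1) * y1 ^ (2 * k - 1 - (2 * k - 1))"
    "\<bar>real_of_int s'\<bar> \<le> real (2 * m * b_bez m) * H\<^sub>1 ^ (k - 1) * H\<^sub>2"
    by (rule bezout_value[OF zA' zB' k(2)])
  have hs: "h * s = r * y1 ^ (2 * k - 1)" "h * s' = r' * x1 ^ (2 * k - 1)" using r(3) r'(3) by simp_all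
  have h0: "h \<noteq> 0"
  proof
    assume "h = 0"
    then have "r * y1 ^ (2 * k - 1) = 0" using hs(1) by simp
    then show False using r(1) y1(1) by simp
  qed
  have "h dvd r * r' * y1 ^ (2 * k - 1)"
    using hs(1) by (metis dvd_mult2 dvd_triv_left mult.assoc mult.commute)
  moreover have "h dvd r * r' * x1 ^ (2 * k - 1)"
    using hs(2) by (metis dvd_mult dvd_triv_left mult.assoc)
  ultimately have "h dvd gcd (r * r' * x1 ^ (2 * k - 1)) (r * r' * y1 ^ (2 * k - 1))" by simp
  then have "h dvd r * r'" using y1(2) by (simp add: gcd_mult_distrib_int[symmetric])
  then have "\<bar>h\<bar> \<le> \<bar>r\<bar> * \<bar>r'\<bar>"
    using r(1) r'(1) dvd_imp_le_int[of "r * r'" h] by (simp add: Rings.abs_mult)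
  also have "\<dots> \<le> int (b_bez m) * int (b_bez m)" using r(2) r'(2) by (intro mult_mono) simp_all
  finally have "real_of_int \<bar>h\<bar> \<le> real_of_int (int (b_bez m) * int (b_bez m))" by (simp only: of_int_le_iff)
  then have h_le: "\<bar>real_of_int h\<bar> \<le> real (b_bez m) * real (b_bez m)" by simp
  \<comment> \<open>\<open>z\<close> stands for whichever of \<open>x1\<close>, \<open>y1\<close>
    attains the height; comparing sizes in its relation, the factor
    \<open>H\<^sub>1 ^ (k - 1)\<close> of the cofactor cancels.\<close>
  have key: "H\<^sub>1 ^ k \<le> real (b_height m) * H\<^sub>2"
    if "h * s = r * z ^ (2 * k - 1)" "r \<noteq> 0" "\<bar>real_of_int z\<bar> = H\<^sub>1"
      "\<bar>real_of_int s\<bar> \<le> real (2 * m * b_bez m) * H\<^sub>1 ^ (k - 1) * H\<^sub>2" for r s z :: int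
  proof -
    have "1 \<le> \<bar>real_of_int r\<bar>" using \<open>r \<noteq> 0\<close> by linarith
    then have "1 * H\<^sub>1 ^ (2 * k - 1) \<le> \<bar>real_of_int r\<bar> * H\<^sub>1 ^ (2 * k - 1)"
      using height_nonneg by (intro mult_right_mono) simp_all
    also have "\<dots> = \<bar>real_of_int (h * s)\<bar>"
      unfolding that(1) that(3)[symmetric] by (simp add: Rings.abs_mult power_abs)
    also have "\<dots> = \<bar>real_of_int h\<bar> * \<bar>real_of_int s\<bar>" by (simp add: Rings.abs_mult)
    also have "\<dots> \<le> (real (b_bez m) * real (b_bez m)) * (real (2 * m * b_bez m) * H\<^sub>1 ^ (k - 1) * H\<^sub>2)"
      using h_le that(4) by (intro mult_mono) simp_all
    also have "\<dots> = H\<^sub>1 ^ (k - 1) * (real (b_height m) * H\<^sub>2)"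
      by (simp add: b_height_def power3_eq_cube)
    finally have "H\<^sub>1 ^ (k - 1) * H\<^sub>1 ^ k \<le> H\<^sub>1 ^ (k - 1) * (real (b_height m) * H\<^sub>2)"
      using degrees(4) by (simp flip: power_add add: mult_2)
    then show ?thesis using height_bounds(3)[OF y1(1), of x1] by simp
  qed
  have "\<bar>real_of_int x1\<bar> = H\<^sub>1 \<or> \<bar>real_of_int y1\<bar> = H\<^sub>1" by (simp add: height_def max_def)
  then have "H\<^sub>1 ^ k \<le> real (b_height m) * H\<^sub>2"
    using key[OF hs(1) r(1) _ r(4)] key[OF hs(2) r'(1) _ r'(4)] by blast
  then show thesis using that h hA h0 by blast
qed

text \<open>Liouville's inequality: \<open>y1 ^ d * F(\<xi>)\<close> is a nonzero integer of size at
  most a constant times \<open>H\<^sub>1 ^ d\<close>. The power \<open>k\<close> of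
  \<open>abs_p (of_int y1)\<close> is retained since the upper estimate for
  \<open>\<xi> - \<alpha>\<close> carries it too.\<close>

lemma abs_xi_diff_ge:
  "1 \<le> real ((m + 1) * b_coeff m) * M ^ m * H\<^sub>1 ^ d * (abs_p (of_int y1) ^ k * abs_p (\<xi> - \<alpha>))"
proof -
  have F1: "int_bounded (b_coeff m) F" using F(1) by (simp add: b_coeff_def)
  have dF: "degree F \<le> d" using F(2) by simp
  obtain z where z: "of_int z = of_int y1 ^ d * poly F q" "of_int z = of_int y1 ^ d * ev F \<xi>"
    "\<bar>real_of_int z\<bar> \<le> real ((d + 1) * b_coeff m) * H\<^sub>1 ^ d"
    by (rule homogenized[OF F1 dF])
  have "z \<noteq> 0"
  proof
    assume "z = 0"
    then show False using z(1) y1(1) poly_F_nonzero[of q] by simp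
  qed
  let ?D = "abs_p (of_int y1) ^ k * abs_p (\<xi> - \<alpha>)"
  have D0: "0 \<le> ?D" using abs_nonneg by simp
  have "abs_p (of_int z) = abs_p (of_int y1) ^ d * abs_p (ev F \<xi> - ev F \<alpha>)"
    unfolding z(2) F(4) by (simp add: abs_mult abs_power)
  also have "\<dots> \<le> abs_p (of_int y1) ^ k * (abs_p (\<xi> - \<alpha>) * M ^ d)"
  proof (intro mult_mono)
    show "abs_p (of_int y1) ^ d \<le> abs_p (of_int y1) ^ k"
      using pair(2) abs_nonneg abs_y1(1) by (intro power_decreasing) simp_all
    show "abs_p (ev F \<xi> - ev F \<alpha>) \<le> abs_p (\<xi> - \<alpha>) * M ^ d"
      by (rule abs_ev_diff_le[OF F1 dF abs_xi_le abs_alpha_le_M M_ge_1])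
  qed (use abs_nonneg in simp_all)
  also have "\<dots> \<le> ?D * M ^ m"
    unfolding mult.assoc[symmetric] using D0 degree_less_m
    by (intro mult_left_mono M_power_le) simp_all
  finally have z_le: "abs_p (of_int z) \<le> ?D * M ^ m" .
  have c: "real ((d + 1) * b_coeff m) \<le> real ((m + 1) * b_coeff m)"
    using degree_less_m by (intro of_nat_mono mult_le_mono1) simp
  have cancel: "1 / \<bar>x\<bar> * \<bar>x\<bar> = 1" if "x \<noteq> 0" for x :: real using that by simp
  have "1 / \<bar>real_of_int z\<bar> \<le> ?D * M ^ m" using abs_of_int_ge[OF \<open>z \<noteq> 0\<close>] z_le by simp
  moreover have "\<bar>real_of_int z\<bar> \<le> real ((m + 1) * b_coeff m) * H\<^sub>1 ^ d"
    using z(3) mult_right_mono[OF c zero_le_power[OF height_nonneg]] by (rule order_trans)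
  ultimately have "1 / \<bar>real_of_int z\<bar> * \<bar>real_of_int z\<bar> \<le> (?D * M ^ m) * (real ((m + 1) * b_coeff m) * H\<^sub>1 ^ d)"
    using M_ge_1 by (intro mult_mono mult_nonneg_nonneg zero_le_power) (simp_all add: abs_nonneg)
  moreover have "real_of_int z \<noteq> 0" using \<open>z \<noteq> 0\<close> by simp
  ultimately have "1 \<le> (?D * M ^ m) * (real ((m + 1) * b_coeff m) * H\<^sub>1 ^ d)" using cancel by metis
  then show ?thesis by (simp only: mult_ac)
qed

text \<open>Near \<open>\<alpha>\<close> the difference \<open>A/B - \<beta>\<close> has a simple zero, its derivative there being essentially
  the Wronskian.\<close>

lemma simple_zero:
  "abs_p (\<xi> - \<alpha>) \<le> 2 * real (b_low m) * M ^ d * abs_p (ev B \<alpha> * ev A \<xi> - ev A \<alpha> * ev B \<xi>)"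
proof -
  let ?D = "abs_p (\<xi> - \<alpha>)" and ?w = "ev (wronskian A B) \<alpha>"
  let ?X = "ev B \<alpha> * ev A \<xi> - ev A \<alpha> * ev B \<xi>"
  let ?TA = "ev A \<xi> - ev A \<alpha> - (\<xi> - \<alpha>) * ev (pderiv A) \<alpha>"
  let ?TB = "ev B \<xi> - ev B \<alpha> - (\<xi> - \<alpha>) * ev (pderiv B) \<alpha>"
  have b: "1 \<le> real (b_low m)" using b_low_ge_1 by simp
  \<comment> \<open>The linear Taylor terms of \<open>A\<close> and \<open>B\<close> combine to the
    Wronskian; the remainders \<open>?TA\<close> and \<open>?TB\<close> are quadratic in
    \<open>\<xi> - \<alpha>\<close>.\<close>
  have eq: "(\<xi> - \<alpha>) * ?w = ?X - (ev B \<alpha> * ?TA - ev A \<alpha> * ?TB)"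
    by (simp add: wronskian_def ev_diff ev_mult algebra_simps)
  have err: "abs_p (ev P \<alpha> * (ev Q \<xi> - ev Q \<alpha> - (\<xi> - \<alpha>) * ev (pderiv Q) \<alpha>)) \<le> M ^ k * (?D ^ 2 * M ^ k)"
    if "int_bounded (b_AB m) P" "int_bounded (b_AB m) Q" "degree P \<le> k" "degree Q \<le> k" for P Q
    unfolding abs_mult using M_ge_1 abs_nonneg
    by (intro mult_mono abs_ev_le[OF that(1,3) abs_alpha_le_M M_ge_1]
        abs_ev_taylor_le[OF that(2,4) abs_xi_le abs_alpha_le_M M_ge_1]) simp_all
  have E: "abs_p (ev B \<alpha> * ?TA - ev A \<alpha> * ?TB) \<le> M ^ k * (?D ^ 2 * M ^ k)"
    using err[OF pair(6,5) degrees(2,1)] err[OF pair(5,6) degrees(1,2)] by (rule abs_diff_le_bound)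
  have w: "1 / (real (b_low m) * M ^ d) \<le> abs_p ?w"
    by (rule abs_wronskian_ge[OF pair(2) degrees(4) pair(3) degrees(1,2) pair(4-6)])
  \<comment> \<open>One factor \<open>?D\<close> of the quadratic error is bounded by
    \<open>abs_xi_diff_small\<close>, so that the error takes at most half of the lower bound for
    the linear term.\<close>
  have "M ^ k * (?D ^ 2 * M ^ k) = ?D * (M ^ (2 * k) * ?D)"
    by (simp add: power2_eq_square mult_2 power_add)
  also have "M ^ (2 * k) * ?D \<le> M ^ (2 * k) * (1 / (2 * M ^ (3 * m) * real (b_low m)))"
    using M_ge_1 by (intro mult_left_mono abs_xi_diff_small) simp
  also have "\<dots> \<le> 1 / (2 * (real (b_low m) * M ^ d))"
  proof -
    have "M ^ (2 * k) * M ^ d \<le> M ^ (3 * m)"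
      unfolding power_add[symmetric] using pair(2) degree_less_m by (intro M_power_le) simp
    moreover have "0 < M" using M_ge_1 by simp
    ultimately show ?thesis using b by (simp add: divide_simps mult.commute)
  qed
  finally have "M ^ k * (?D ^ 2 * M ^ k) \<le> ?D * (1 / (2 * (real (b_low m) * M ^ d)))"
    using abs_nonneg[of "\<xi> - \<alpha>"] by (simp add: mult_left_mono)
  moreover have "?D * (1 / (real (b_low m) * M ^ d)) \<le> abs_p ((\<xi> - \<alpha>) * ?w)"
    unfolding abs_mult by (intro mult_left_mono w abs_nonneg)
  moreover have "abs_p ((\<xi> - \<alpha>) * ?w) \<le> abs_p ?X + abs_p (ev B \<alpha> * ?TA - ev A \<alpha> * ?TB)"
    unfolding eq by (rule abs_diff_le)
  ultimately have "?D * (1 / (real (b_low m) * M ^ d)) \<le> abs_p ?X + ?D * (1 / (2 * (real (b_low m) * M ^ d)))"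
    using E by linarith
  moreover have "?D * (1 / (2 * c)) = ?D * (1 / c) / 2" for c :: real by simp
  moreover have "u \<le> 2 * v" if "u \<le> v + u / 2" for u v :: real using that by linarith
  ultimately have "?D * (1 / (real (b_low m) * M ^ d)) \<le> 2 * abs_p ?X" by metis
  then show ?thesis using b M_ge_1 by (simp add: divide_le_eq mult_ac)
qed

text \<open>Up to sign, \<open>y1 ^ k\<close> times the determinant in \<open>simple_zero\<close> is
  \<open>h * B(\<alpha>) * (y2 * \<beta> - x2)\<close>, so a good second approximation forces
  \<open>\<xi>\<close> equally close to \<open>\<alpha>\<close>. Liouville's inequality limits
  this.\<close>

lemma liouville_estimate:
  assumes "of_int (h * x2) = of_int y1 ^ k * ev A \<xi>" "of_int (h * y2) = of_int y1 ^ k * ev B \<xi>"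
  shows "1 \<le> real (b_end m) * H\<^sub>1 ^ d * \<delta>\<^sub>2"
proof -
  let ?X = "ev B \<alpha> * ev A \<xi> - ev A \<alpha> * ev B \<xi>"
  let ?y = "abs_p (of_int y1) ^ k"
  have "of_int y1 ^ k * ?X = - (of_int h * ev B \<alpha> * (of_int y2 * \<beta> - of_int x2))"
  proof -
    have "of_int y1 ^ k * ?X = ev B \<alpha> * (of_int y1 ^ k * ev A \<xi>) - ev A \<alpha> * (of_int y1 ^ k * ev B \<xi>)"
      by (simp add: algebra_simps)
    also have "\<dots> = - (of_int h * ev B \<alpha> * (of_int y2 * \<beta> - of_int x2))"
      unfolding assms[symmetric] by (simp add: degrees(3) algebra_simps)
    finally show ?thesis .
  qed
  then have "?y * abs_p ?X = abs_p (of_int h) * abs_p (ev B \<alpha>) * \<delta>\<^sub>2"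
    by (metis abs_mult abs_power abs_minus)
  also have "\<dots> \<le> 1 * M ^ k * \<delta>\<^sub>2"
    using abs_nonneg M_ge_1
    by (intro mult_mono abs_of_int_le_1 abs_ev_le[OF pair(6) degrees(2) abs_alpha_le_M M_ge_1]) simp_all
  finally have X: "?y * abs_p ?X \<le> M ^ k * \<delta>\<^sub>2" by simp
  have "?y * abs_p (\<xi> - \<alpha>) \<le> ?y * (2 * real (b_low m) * M ^ d * abs_p ?X)"
    using abs_nonneg by (intro mult_left_mono simple_zero) simp
  also have "\<dots> = 2 * real (b_low m) * M ^ d * (?y * abs_p ?X)" by (simp only: mult_ac)
  also have "\<dots> \<le> 2 * real (b_low m) * M ^ d * (M ^ k * \<delta>\<^sub>2)"
    using M_ge_1 by (intro mult_left_mono X) simp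
  also have "\<dots> = 2 * real (b_low m) * \<delta>\<^sub>2 * M ^ (d + k)" by (simp add: power_add)
  also have "\<dots> \<le> 2 * real (b_low m) * \<delta>\<^sub>2 * M ^ (2 * m)"
    using abs_nonneg degree_less_m degrees(5) by (intro mult_left_mono M_power_le) simp_all
  finally have D: "?y * abs_p (\<xi> - \<alpha>) \<le> 2 * real (b_low m) * \<delta>\<^sub>2 * M ^ (2 * m)" .
  have "1 \<le> real ((m + 1) * b_coeff m) * M ^ m * H\<^sub>1 ^ d * (?y * abs_p (\<xi> - \<alpha>))" by (rule abs_xi_diff_ge)
  also have "\<dots> \<le> real ((m + 1) * b_coeff m) * M ^ m * H\<^sub>1 ^ d * (2 * real (b_low m) * \<delta>\<^sub>2 * M ^ (2 * m))"
    using M_ge_1 height_nonneg by (intro mult_left_mono D) simp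
  also have "\<dots> = real (b_end m) * H\<^sub>1 ^ d * \<delta>\<^sub>2"
  proof -
    have "M ^ (3 * m) = M ^ m * M ^ (2 * m)" by (simp flip: power_add)
    then show ?thesis by (simp add: b_end_def M_def[symmetric] mult_ac)
  qed
  finally show ?thesis .
qed

end

section \<open>Growth of the constants\<close>

lemma elementary_fact: "elementary g \<Longrightarrow> elementary (\<lambda>m. fact (g m))"
  by (rule elementary_mono[OF elementary_power]) (auto intro: fact_le_power[where 'a = nat, simplified])

lemma elementary_solution_bound:
  "elementary g \<Longrightarrow> elementary h \<Longrightarrow> elementary (\<lambda>m. solution_bound (g m) (h m))"
  unfolding solution_bound_def by (intro elementary_mult elementary_power elementary_const)

text \<open>This supplies one tower height for all values of \<open>m\<close>, and thereby a program
  that is independent of \<open>\<alpha>\<close> and \<open>\<beta>\<close>.\<close>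

lemma elementary_b_total: "elementary b_total"
proof -
  note intros = elementary_add elementary_mult elementary_power elementary_const elementary_ident
    elementary_fact elementary_solution_bound
  have "elementary (\<lambda>m. b_coeff m)" unfolding b_coeff_def by (intro intros)
  then have AB: "elementary (\<lambda>m. b_AB m)" unfolding b_AB_def by (intro intros)
  have "elementary (\<lambda>m. b_bez m)" unfolding b_bez_def by (intro intros AB)
  then have height: "elementary (\<lambda>m. b_height m)" unfolding b_height_def by (intro intros)
  have "elementary (\<lambda>m. b_W m)" unfolding b_W_def
    by (intro intros AB \<open>elementary (\<lambda>m. b_coeff m)\<close>)
  then have low: "elementary (\<lambda>m. b_low m)" unfolding b_low_def by (intro intros)
  have "elementary (\<lambda>m. b_gap m)" unfolding b_gap_def by (intro intros AB)
  moreover have "elementary (\<lambda>m. b_small m)" unfolding b_small_def by (intro intros low)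
  moreover have "elementary (\<lambda>m. b_end m)" unfolding b_end_def
    by (intro intros low \<open>elementary (\<lambda>m. b_coeff m)\<close>)
  ultimately have "elementary (\<lambda>m. b_total m)" unfolding b_total_def by (intro intros height)
  then show ?thesis .
qed

context approximation_setting
begin

lemma b_small_ge_1: "1 \<le> b_small m"
  using b_low_ge_1 by (simp add: b_small_def Suc_le_eq)

lemma b_height_ge_1: "1 \<le> b_height m"
  using b_bez_ge_1 m_ge_1 by (simp add: b_height_def Suc_le_eq)

end

context approximation_pair
begin

text \<open>For \<open>k = 1\<close> the integer coefficients of the linear polynomials
  \<open>A\<close> and \<open>B\<close> are the required \<open>s, t, u, v\<close>, and the common
  factor \<open>h\<close> cancels from the fraction.\<close>

lemma moebius_case:
  assumes "k = 1"
    and zA: "of_int (h * x2) = of_int y1 ^ k * poly A q"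
    and zB: "of_int (h * y2) = of_int y1 ^ k * poly B q"
    and "h \<noteq> 0"
  shows "\<exists>s t u v :: int. s * v - t * u \<noteq> 0 \<and> of_int u * \<alpha> + of_int v \<noteq> 0 \<and>
      \<beta> = (of_int s * \<alpha> + of_int t) / (of_int u * \<alpha> + of_int v) \<and> u * x1 + v * y1 \<noteq> 0 \<and>
      (of_int x2 / of_int y2 :: rat) = of_int (s * x1 + t * y1) / of_int (u * x1 + v * y1)"
proof -
  have linear: "\<exists>s t :: int. P = [:of_int t, of_int s:]" if bd: "int_bounded L P" "degree P \<le> k" for L P
  proof -
    obtain t where t: "coeff P 0 = of_int t" using bd(1) unfolding int_bounded_def by blast
    obtain s where s: "coeff P 1 = of_int s" using bd(1) unfolding int_bounded_def by blast
    have "coeff P i = coeff [:of_int t, of_int s:] i" for i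
    proof (cases "i \<le> 1")
      case True
      then have "i = 0 \<or> i = 1" by linarith
      then show ?thesis using s t by auto
    next
      case False
      then show ?thesis using bd(2) assms(1) by (simp add: coeff_eq_0)
    qed
    then have "P = [:of_int t, of_int s:]" by (rule poly_eqI)
    then show ?thesis by blast
  qed
  obtain s t :: int where A: "A = [:of_int t, of_int s:]" using linear[OF pair(5) degrees(1)] by blast
  obtain u v :: int where B: "B = [:of_int v, of_int u:]" using linear[OF pair(6) degrees(2)] by blast
  have evA: "ev A \<alpha> = of_int s * \<alpha> + of_int t" and evB: "ev B \<alpha> = of_int u * \<alpha> + of_int v"
    by (simp_all add: A B map_poly_pCons)
  have B0: "ev B \<alpha> \<noteq> 0" by (rule represents_degree_B(2)[OF pair(1,2)])
  have beta: "\<beta> = ev A \<alpha> / ev B \<alpha>" using degrees(3) B0 by simp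
  have val: "of_int y1 ^ k * poly [:of_int c, of_int e:] q = (of_int (e * x1 + c * y1) :: rat)" for c e
    using y1(1) by (simp add: assms(1) q_def algebra_simps)
  have hA: "h * x2 = s * x1 + t * y1" using zA unfolding A val by (simp only: of_int_eq_iff)
  have hB: "h * y2 = u * x1 + v * y1" using zB unfolding B val by (simp only: of_int_eq_iff)
  have "s * v - t * u \<noteq> 0"
  proof
    assume "s * v - t * u = 0"
    then have sv: "of_int s * of_int v = (of_int t * of_int u :: 'a)" by (simp flip: of_int_mult)
    \<comment> \<open>A zero determinant gives \<open>u * \<beta> = s\<close>: either
      \<open>\<beta>\<close> is rational, or \<open>u = s = 0\<close> and both polynomials are
      constant, although one has degree 1.\<close>
    have "of_int u * ev A \<alpha> = of_int s * ev B \<alpha>" unfolding evA evB using sv by (simp add: algebra_simps)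
    then have eq: "of_int u * \<beta> = of_int s" unfolding beta using B0 by (simp add: field_simps)
    show False
    proof (cases "u = 0")
      case True
      then have "s = 0" using eq by simp
      then show False using True pair(4) assms(1) A B by simp
    next
      case False
      then have "\<beta> = of_int s / of_int u" using eq by (simp add: field_simps)
      then show False using irrational by simp
    qed
  qed
  moreover have "u * x1 + v * y1 \<noteq> 0" unfolding hB[symmetric] using assms(4) y2(1) by simp
  moreover have "(of_int x2 / of_int y2 :: rat) = of_int (s * x1 + t * y1) / of_int (u * x1 + v * y1)"
    unfolding hA[symmetric] hB[symmetric] using assms(4) by simp
  ultimately show ?thesis using beta B0 unfolding evA evB by blast
qed

end

section \<open>The gap principle and its computable constants\<close>

text \<open>One number \<open>C\<close> plays the part of both constants. Only a lower bound on it
  is required, which leaves the choice of a conveniently computable value open.\<close>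

lemma (in approximation_setting) gap_principle:
  fixes x1 y1 x2 y2 :: int
  assumes mu: "real d / 2 + 1 < \<mu>" "\<mu> < real d" and "0 < C\<^sub>0"
    and C: "real (b_total m) * (1 + C\<^sub>0) \<le> C"
    and y1: "y1 \<noteq> 0" "coprime x1 y1" and y2: "y2 \<noteq> 0" "coprime x2 y2"
    and H: "height x1 y1 \<le> height x2 y2" "C \<le> height x1 y1"
    and close1: "abs_p (of_int y1 * \<alpha> - of_int x1) < C\<^sub>0 / height x1 y1 powr \<mu>"
    and close2: "abs_p (of_int y2 * \<beta> - of_int x2) < C\<^sub>0 / height x2 y2 powr \<mu>"
  shows "inverse C * height x1 y1 powr (\<mu> - real d / 2) < height x2 y2 \<or>
    (\<exists>s t u v :: int. s * v - t * u \<noteq> 0 \<and> of_int u * \<alpha> + of_int v \<noteq> 0 \<and>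
      \<beta> = (of_int s * \<alpha> + of_int t) / (of_int u * \<alpha> + of_int v) \<and> u * x1 + v * y1 \<noteq> 0 \<and>
      (of_int x2 / of_int y2 :: rat) = of_int (s * x1 + t * y1) / of_int (u * x1 + v * y1))"
proof -
  define X where "X = height x1 y1"
  define Y where "Y = height x2 y2"
  have X1: "1 \<le> X" and Y1: "1 \<le> Y" using height_bounds(3) y1(1) y2(1) by (simp_all add: X_def Y_def)
  have XY: "X \<le> Y" and CX: "C \<le> X" using H by (simp_all add: X_def Y_def)
  have mu1: "1 < \<mu>" using mu(1) degree_ge by linarith
  have small: "1 \<le> real (b_small m)" and height: "1 \<le> real (b_height m)"
    using b_small_ge_1 b_height_ge_1 by simp_all
  have total: "real (b_total m) = real (b_gap m) + real (b_small m) + real (b_end m) * real (b_height m) ^ m"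
    by (simp add: b_total_def)
  then have "0 < real (b_total m)" using small by (simp add: add_nonneg_pos add_pos_nonneg)
  \<comment> \<open>The summand 1 in \<open>1 + C\<^sub>0\<close> makes these inequalities
    strict.\<close>
  have C_gt: "c * C\<^sub>0 < C" if "c \<le> real (b_total m)" for c
  proof -
    have "c * C\<^sub>0 \<le> real (b_total m) * C\<^sub>0" using that \<open>0 < C\<^sub>0\<close> by (intro mult_right_mono) simp_all
    then show ?thesis using C \<open>0 < real (b_total m)\<close> by (simp add: distrib_left)
  qed
  have C0: "0 < C" using C_gt[of 0] \<open>0 < real (b_total m)\<close> by simp
  \<comment> \<open>This secures the closeness hypothesis of \<open>approximation_pair\<close>; as
    \<open>1 < \<mu>\<close>, the bound on \<open>X\<close> also bounds
    \<open>X powr \<mu>\<close>.\<close>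
  have "real (b_small m) * C\<^sub>0 < X" using C_gt[of "real (b_small m)"] CX total by simp
  also have "X \<le> X powr \<mu>" using powr_mono[of 1 \<mu> X] mu1 X1 by simp
  finally have "C\<^sub>0 / X powr \<mu> < 1 / real (b_small m)"
    using X1 small by (simp add: divide_simps mult.commute)
  then have "abs_p (of_int y1 * \<alpha> - of_int x1) < 1 / real (b_small m)"
    using close1 unfolding X_def by linarith
  moreover obtain k A B where pair: "represents k A B" "2 * k \<le> d" "coprime A B" "degree A = k \<or> degree B = k"
    "int_bounded (b_AB m) A" "int_bounded (b_AB m) B"
    by (rule ex_minimal_pair)
  ultimately interpret approximation_pair p abs_p \<alpha> \<beta> b m k A B x1 y1 x2 y2
    using y1 y2 by unfold_locales
  obtain zA where zA: "of_int zA = of_int y1 ^ k * poly A q" "of_int zA = of_int y1 ^ k * ev A \<xi>"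
    "\<bar>real_of_int zA\<bar> \<le> real ((k + 1) * b_AB m) * X ^ k"
    unfolding X_def by (rule homogenized[OF pair(5) degrees(1)])
  obtain zB where zB: "of_int zB = of_int y1 ^ k * poly B q" "of_int zB = of_int y1 ^ k * ev B \<xi>"
    "\<bar>real_of_int zB\<bar> \<le> real ((k + 1) * b_AB m) * X ^ k"
    unfolding X_def by (rule homogenized[OF pair(6) degrees(2)])
  show ?thesis
  proof (cases "y2 * zA = x2 * zB")
    case False
    define E where "E = C\<^sub>0 / X powr \<mu>"
    have "C\<^sub>0 / Y powr \<mu> \<le> E"
      unfolding E_def using XY X1 mu1 \<open>0 < C\<^sub>0\<close> by (intro divide_left_mono powr_mono2) simp_all
    then have "\<delta>\<^sub>1 \<le> E" "\<delta>\<^sub>2 \<le> E" using close1 close2 by (simp_all add: E_def X_def Y_def)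
    then have "1 \<le> E * real (b_gap m) * X ^ k * Y"
      unfolding X_def Y_def using zA(2,3) zB(2,3) False unfolding X_def by (intro gap_if_unequal)
    then have "X powr \<mu> \<le> real (b_gap m) * C\<^sub>0 * Y * X ^ k"
      using X1 by (simp add: E_def divide_simps mult_ac)
    moreover have "X powr \<mu> = X powr (\<mu> - real k) * X ^ k"
      using X1 powr_add[of X "\<mu> - real k" "real k"] by (simp add: powr_realpow)
    ultimately have "X powr (\<mu> - real k) \<le> real (b_gap m) * C\<^sub>0 * Y" using X1 by simp
    \<comment> \<open>The exponent of alternative (i) comes from
      \<open>k \<le> d / 2\<close>.\<close>
    moreover have "X powr (\<mu> - real d / 2) \<le> X powr (\<mu> - real k)"
      using X1 pair(2) by (intro powr_mono) simp_all
    moreover have "real (b_gap m) * C\<^sub>0 * Y < C * Y"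
      using C_gt[of "real (b_gap m)"] total Y1 by (intro mult_strict_right_mono) simp_all
    ultimately have "X powr (\<mu> - real d / 2) < C * Y" by linarith
    then have "inverse C * X powr (\<mu> - real d / 2) < Y" using C0 by (simp add: field_simps)
    then show ?thesis by (simp add: X_def Y_def)
  next
    case True
    obtain h where h: "zA = h * x2" "zB = h * y2" "h \<noteq> 0" "X ^ k \<le> real (b_height m) * Y"
      unfolding X_def Y_def by (rule common_factor[OF zA(1) zB(1) True])
    show ?thesis
    proof (cases "k = 1")
      case True
      then show ?thesis using moebius_case[of h] zA(1) zB(1) h by simp
    next
      case False
      then have "2 \<le> k" using degrees(4) by simp
      \<comment> \<open>The case \<open>k \<ge> 2\<close> is contradictory. \<open>Y\<close> is at
        least of order \<open>X ^ 2\<close>, while \<open>liouville_estimate\<close> bounds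
        \<open>Y powr \<mu>\<close> by a constant times \<open>X ^ d\<close>; since
        \<open>2 * \<mu> > d\<close>, this cannot hold for large \<open>X\<close>.\<close>
      then have "X ^ 2 \<le> X ^ k" using X1 by (intro power_increasing)
      then have "X ^ 2 \<le> real (b_height m) * Y" using h(4) by linarith
      then have "(X ^ 2) powr \<mu> \<le> (real (b_height m) * Y) powr \<mu>" using mu1 by (intro powr_mono2) simp_all
      also have "\<dots> = real (b_height m) powr \<mu> * Y powr \<mu>" using Y1 by (simp add: powr_mult)
      also have "\<dots> \<le> real (b_height m) ^ m * Y powr \<mu>"
      proof -
        have "real (b_height m) powr \<mu> \<le> real (b_height m) powr real m"
          using height mu(2) degree_less_m by (intro powr_mono) simp_all
        then show ?thesis using height by (intro mult_right_mono) (simp_all add: powr_realpow)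
      qed
      finally have X2: "(X ^ 2) powr \<mu> \<le> real (b_height m) ^ m * Y powr \<mu>" .
      have "1 \<le> real (b_end m) * X ^ d * \<delta>\<^sub>2"
        unfolding X_def using zA(2) zB(2) unfolding h(1,2) by (rule liouville_estimate)
      also have "\<dots> \<le> real (b_end m) * X ^ d * (C\<^sub>0 / Y powr \<mu>)"
        using close2 X1 unfolding Y_def by (intro mult_left_mono) simp_all
      finally have "Y powr \<mu> \<le> real (b_end m) * X ^ d * C\<^sub>0" using Y1 by (simp add: divide_simps)
      then have "real (b_height m) ^ m * Y powr \<mu> \<le> real (b_height m) ^ m * (real (b_end m) * X ^ d * C\<^sub>0)"
        by (intro mult_left_mono) simp_all
      then have "(X ^ 2) powr \<mu> \<le> (real (b_end m) * real (b_height m) ^ m) * C\<^sub>0 * X ^ d"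
        using X2 by (simp add: mult_ac)
      also have "\<dots> < C * X ^ d"
        using C_gt[of "real (b_end m) * real (b_height m) ^ m"] total X1
        by (intro mult_strict_right_mono) simp_all
      also have "\<dots> \<le> X * X ^ d" using CX X1 by (intro mult_right_mono) simp_all
      also have "\<dots> = X powr (1 + real d)" using X1 by (simp add: powr_add powr_realpow)
      \<comment> \<open>\<open>2 * \<mu>\<close> exceeds \<open>d + 2\<close>, which leaves room for
        the extra factor \<open>X\<close> that absorbed \<open>C\<close>.\<close>
      also have "\<dots> \<le> X powr (2 * \<mu>)" using X1 mu(1) by (intro powr_mono) simp_all
      also have "\<dots> = (X ^ 2) powr \<mu>" using X1 powr_powr[of X 2 \<mu>] by (simp add: powr_realpow)
      finally show ?thesis by simp
    qed
  qed
qed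

theorem theorem1p2:
  fixes p :: nat and abs_p :: "'a::field_char_0 \<Rightarrow> real"
  assumes "prime p" and "padic_numbers p abs_p"
  shows "\<exists>e\<^sub>3 e\<^sub>4. \<forall>(\<alpha>::'a) (\<beta>::'a) (d::nat) (\<mu>::real) (C\<^sub>0::real).
    algebraic \<alpha> \<and> d = alg_degree \<alpha> \<and> 3 \<le> d \<and>
    \<beta> \<in> rat_adjoin \<alpha> \<and> \<beta> \<notin> \<rat> \<and>
    real d / 2 + 1 < \<mu> \<and> \<mu> < real d \<and> 0 < C\<^sub>0 \<longrightarrow>
    (\<exists>C\<^sub>3>0. \<exists>C\<^sub>4>0.
      computes_from p abs_p e\<^sub>3 \<alpha> \<beta> \<mu> C\<^sub>0 C\<^sub>3 \<and>
      computes_from p abs_p e\<^sub>4 \<alpha> \<beta> \<mu> C\<^sub>0 C\<^sub>4 \<and>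
      (\<forall>x\<^sub>1 y\<^sub>1 x\<^sub>2 y\<^sub>2 :: int.
        y\<^sub>1 \<noteq> 0 \<and> coprime x\<^sub>1 y\<^sub>1 \<and> y\<^sub>2 \<noteq> 0 \<and> coprime x\<^sub>2 y\<^sub>2 \<and>
        height x\<^sub>2 y\<^sub>2 \<ge> height x\<^sub>1 y\<^sub>1 \<and> height x\<^sub>1 y\<^sub>1 \<ge> C\<^sub>3 \<and>
        abs_p (of_int y\<^sub>1 * \<alpha> - of_int x\<^sub>1) < C\<^sub>0 / height x\<^sub>1 y\<^sub>1 powr \<mu> \<and>
        abs_p (of_int y\<^sub>2 * \<beta> - of_int x\<^sub>2) < C\<^sub>0 / height x\<^sub>2 y\<^sub>2 powr \<mu> \<longrightarrow>
        height x\<^sub>2 y\<^sub>2 > inverse C\<^sub>4 * height x\<^sub>1 y\<^sub>1 powr (\<mu> - real d / 2) \<or>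
        (\<exists>s t u v :: int.
          s * v - t * u \<noteq> 0 \<and>
          of_int u * \<alpha> + of_int v \<noteq> 0 \<and>
          \<beta> = (of_int s * \<alpha> + of_int t) / (of_int u * \<alpha> + of_int v) \<and>
          u * x\<^sub>1 + v * y\<^sub>1 \<noteq> 0 \<and>
          (of_int x\<^sub>2 / of_int y\<^sub>2 :: rat) =
            of_int (s * x\<^sub>1 + t * y\<^sub>1) / of_int (u * x\<^sub>1 + v * y\<^sub>1))))"
proof -
  interpret padic_field p abs_p
    using assms by (intro padic_field.intro padic_field_axioms.intro)
  \<comment> \<open>The height \<open>i\<close> is fixed before \<open>\<alpha>\<close>,
    \<open>\<beta>\<close>, \<open>\<mu>\<close> and \<open>C\<^sub>0\<close>, as the order of
    quantifiers demands of the program.\<close>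
  obtain i where i: "\<And>m. b_total m \<le> tower i m"
    using elementary_b_total unfolding elementary_def by blast
  let ?e = "constant_program i"
  show ?thesis
  proof (rule exI[of _ ?e], rule exI[of _ ?e], intro allI impI, elim conjE)
    fix \<alpha> \<beta> :: 'a and d :: nat and \<mu> C\<^sub>0 :: real
    assume alg: "algebraic \<alpha>" and d: "d = alg_degree \<alpha>" "3 \<le> d"
      and \<beta>: "\<beta> \<in> rat_adjoin \<alpha>" "\<beta> \<notin> \<rat>"
      and \<mu>: "real d / 2 + 1 < \<mu>" "\<mu> < real d" and C\<^sub>0: "0 < C\<^sub>0"
    obtain b where b: "degree b < alg_degree \<alpha>" "\<beta> = ev b \<alpha>"
      using rat_adjoin_coordinates[OF alg \<beta>(1)] by blast
    \<comment> \<open>The sum dominates both codes and is the number that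
      \<open>tower_program\<close> forms from its arguments.\<close>
    define m where "m = rat_poly_code (min_poly \<alpha>) + rat_poly_code b"
    interpret approximation_setting p abs_p \<alpha> \<beta> b m
      using alg d \<beta> b by unfold_locales (simp_all add: m_def)
    define C where "C = 2 ^ tower i m * (1 + C\<^sub>0)"
    have C: "0 < C" using C\<^sub>0 by (simp add: C_def)
    have comp: "computes_from p abs_p ?e \<alpha> \<beta> \<mu> C\<^sub>0 C"
      unfolding C_def by (rule constant_program_computes[OF alg b C\<^sub>0]) (simp add: m_def)
    have "b_total m \<le> 2 ^ tower i m"
      using i[of m] less_exp[of "tower i m"] by linarith
    then have "real (b_total m) \<le> real (2 ^ tower i m)" by (simp only: of_nat_le_iff)
    then have "real (b_total m) * (1 + C\<^sub>0) \<le> C"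
      unfolding C_def using C\<^sub>0 by (intro mult_right_mono) simp_all
    note gap = gap_principle[OF \<mu>[unfolded d(1)] C\<^sub>0 this]
    show "\<exists>C\<^sub>3>0. \<exists>C\<^sub>4>0.
      computes_from p abs_p ?e \<alpha> \<beta> \<mu> C\<^sub>0 C\<^sub>3 \<and>
      computes_from p abs_p ?e \<alpha> \<beta> \<mu> C\<^sub>0 C\<^sub>4 \<and>
      (\<forall>x\<^sub>1 y\<^sub>1 x\<^sub>2 y\<^sub>2 :: int.
        y\<^sub>1 \<noteq> 0 \<and> coprime x\<^sub>1 y\<^sub>1 \<and> y\<^sub>2 \<noteq> 0 \<and> coprime x\<^sub>2 y\<^sub>2 \<and>
        height x\<^sub>2 y\<^sub>2 \<ge> height x\<^sub>1 y\<^sub>1 \<and> height x\<^sub>1 y\<^sub>1 \<ge> C\<^sub>3 \<and>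
        abs_p (of_int y\<^sub>1 * \<alpha> - of_int x\<^sub>1) < C\<^sub>0 / height x\<^sub>1 y\<^sub>1 powr \<mu> \<and>
        abs_p (of_int y\<^sub>2 * \<beta> - of_int x\<^sub>2) < C\<^sub>0 / height x\<^sub>2 y\<^sub>2 powr \<mu> \<longrightarrow>
        height x\<^sub>2 y\<^sub>2 > inverse C\<^sub>4 * height x\<^sub>1 y\<^sub>1 powr (\<mu> - real d / 2) \<or>
        (\<exists>s t u v :: int.
          s * v - t * u \<noteq> 0 \<and>
          of_int u * \<alpha> + of_int v \<noteq> 0 \<and>
          \<beta> = (of_int s * \<alpha> + of_int t) / (of_int u * \<alpha> + of_int v) \<and>
          u * x\<^sub>1 + v * y\<^sub>1 \<noteq> 0 \<and>
          (of_int x\<^sub>2 / of_int y\<^sub>2 :: rat) =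
            of_int (s * x\<^sub>1 + t * y\<^sub>1) / of_int (u * x\<^sub>1 + v * y\<^sub>1)))"
      unfolding d(1)
      by (intro exI[of _ C] conjI C comp allI impI, elim conjE) (rule gap)
  qed
qed

end
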